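(* If $(M,g,J)$ is a Hermitian manifold of real dimension $2m+2$ with $Hol(\nabla^a)\subset U(m)\times U(1)$, with corresponding splitting $TM=\mathcal{H}\oplus\mathcal{V}$, and $$T^a\in\Lambda^{2,0}\mathcal{H}^*\otimes\Lambda^{0,1}\mathcal{V}^*\oplus\Lambda^{0,2}\mathcal{H}^*\otimes\Lambda^{1,0}\mathcal{V}^*,$$ then $\nabla^aT^a=0$.
   Context: Manifolds are smooth and connected. A Hermitian manifold is $(M,g,J)$ with $J$ an integrable $g$-orthogonal almost complex structure. $\nabla^a$ is the unique connection with $\nabla^a g=0$, $\nabla^a J=0$ whose torsion $T^a$, viewed as $T^a(X,Y,Z)=g(T^a(X,Y),Z)$, is a 3-form; $\nabla^a=\nabla+\frac12T^a$ with $\nabla$ the Levi-Civita connection. $Hol(\nabla^a)\subset U(m)\times U(1)\subset U(m+1)$ means that there is a (fixed) $\nabla^a$-parallel, $g$-orthogonal, $J$-invariant splitting $TM=\mathcal{H}\oplus\mathcal{V}$ with real ranks $2m$ and $2$. $\Lambda^{p,q}\mathcal{H}^*$, $\Lambda^{p,q}\mathcal{V}^*$ are the complex $(p,q)$-forms on $\mathcal{H}$, $\mathcal{V}$ with respect to $J$ (extended by zero), and tensor products of them are embedded in $\Lambda^3T^*M\otimes\mathbb{C}$ by the wedge product. *)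

theory Defs
  imports "HOL-Analysis.Analysis" "HOL-Library.Function_Algebras"
begin

text \<open>
  The pointwise real vector space structure on functions. It supplies \<open>subspace\<close>, \<open>span\<close>
  and \<open>dim\<close> for tangent spaces, whose elements are functionals, and for spaces of forms.
\<close>

instantiation "fun" :: (type, real_vector) real_vector
begin

definition scaleR_fun :: "real \<Rightarrow> ('a \<Rightarrow> 'b) \<Rightarrow> 'a \<Rightarrow> 'b"
  where "scaleR_fun c f = (\<lambda>x. c *\<^sub>R f x)"

instance
  by standard (auto simp: scaleR_fun_def fun_eq_iff scaleR_add_right scaleR_add_left)

end

definition linear_within ::
    "'v::real_vector set \<Rightarrow> ('v \<Rightarrow> 'w::real_vector) \<Rightarrow> bool" where
  "linear_within S f \<longleftrightarrow>
     (\<forall>u\<in>S. \<forall>v\<in>S. f (u + v) = f u + f v) \<and> (\<forall>c. \<forall>u\<in>S. f (c *\<^sub>R u) = c *\<^sub>R f u)"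

definition bilinear_within ::
    "'v::real_vector set \<Rightarrow> ('v \<Rightarrow> 'v \<Rightarrow> 'w::real_vector) \<Rightarrow> bool" where
  "bilinear_within S b \<longleftrightarrow>
     (\<forall>u\<in>S. linear_within S (b u)) \<and> (\<forall>v\<in>S. linear_within S (\<lambda>u. b u v))"


section \<open>Smooth manifolds\<close>

text \<open>Only meant for open sets \<open>S\<close>.\<close>

primrec Ck_on :: "nat \<Rightarrow> 'e::euclidean_space set \<Rightarrow> ('e \<Rightarrow> 'b::real_normed_vector) \<Rightarrow> bool" where
  "Ck_on 0 S f \<longleftrightarrow> continuous_on S f"
| "Ck_on (Suc k) S f \<longleftrightarrow>
     (\<forall>x\<in>S. f differentiable (at x)) \<and>
     (\<forall>v. Ck_on k S (\<lambda>x. frechet_derivative f (at x) v))"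

definition smooth_on :: "'e::euclidean_space set \<Rightarrow> ('e \<Rightarrow> 'b::real_normed_vector) \<Rightarrow> bool" where
  "smooth_on S f \<longleftrightarrow> (\<forall>k. Ck_on k S f)"

text \<open>
  The underlying space of a manifold is a whole type \<open>'a\<close>. An atlas is a set of charts
  \<open>(U, \<phi>)\<close>, where \<open>\<phi>\<close> is relevant only on \<open>U\<close>; it need not be maximal. The
  Hausdorff and second countability axioms are sort constraints on \<open>'a\<close>.
\<close>

type_synonym ('a, 'e) atlas = "('a set \<times> ('a \<Rightarrow> 'e)) set"

definition smooth_atlas :: "('a::topological_space, 'e::euclidean_space) atlas \<Rightarrow> bool" where
  "smooth_atlas A \<longleftrightarrow>
     (\<Union>(U, \<phi>)\<in>A. U) = UNIV \<and>
     (\<forall>(U, \<phi>)\<in>A. open U \<and> open (\<phi> ` U) \<and> homeomorphism U (\<phi> ` U) \<phi> (inv_into U \<phi>)) \<and>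
     (\<forall>(U, \<phi>)\<in>A. \<forall>(V, \<psi>)\<in>A. smooth_on (\<phi> ` (U \<inter> V)) (\<psi> \<circ> inv_into U \<phi>))"

definition connected_smooth_manifold ::
    "('a::{t2_space, second_countable_topology}, 'e::euclidean_space) atlas \<Rightarrow> bool" where
  "connected_smooth_manifold A \<longleftrightarrow> smooth_atlas A \<and> connected (UNIV :: 'a set)"

definition smooth_functions ::
    "('a::topological_space, 'e::euclidean_space) atlas \<Rightarrow> ('a \<Rightarrow> real) set" where
  "smooth_functions A = {f. \<forall>(U, \<phi>)\<in>A. smooth_on (\<phi> ` U) (f \<circ> inv_into U \<phi>)}"

text \<open>
  Tangent vectors at \<open>p\<close> are the derivations at \<open>p\<close> of the algebra of smooth functions,
  extended by zero to all functions so that equality of tangent vectors is equality in HOL.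
\<close>

type_synonym 'a tvec = "('a \<Rightarrow> real) \<Rightarrow> real"
type_synonym 'a vfield = "'a \<Rightarrow> 'a tvec"

definition tangent_space ::
    "('a::topological_space, 'e::euclidean_space) atlas \<Rightarrow> 'a \<Rightarrow> 'a tvec set" where
  "tangent_space A p =
     {v. linear_within (smooth_functions A) v \<and>
         (\<forall>f\<in>smooth_functions A. \<forall>h\<in>smooth_functions A. v (f * h) = f p * v h + h p * v f) \<and>
         (\<forall>f. f \<notin> smooth_functions A \<longrightarrow> v f = 0)}"

text \<open>The function \<open>X f\<close>.\<close>

definition deriv_along :: "'a vfield \<Rightarrow> ('a \<Rightarrow> real) \<Rightarrow> 'a \<Rightarrow> real" where
  "deriv_along X f = (\<lambda>p. X p f)"

definition vector_fields ::
    "('a::topological_space, 'e::euclidean_space) atlas \<Rightarrow> 'a vfield set" where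
  "vector_fields A =
     {X. (\<forall>p. X p \<in> tangent_space A p) \<and>
         (\<forall>f\<in>smooth_functions A. deriv_along X f \<in> smooth_functions A)}"

definition fmult :: "('a \<Rightarrow> real) \<Rightarrow> 'a vfield \<Rightarrow> 'a vfield" where
  "fmult f X = (\<lambda>p. f p *\<^sub>R X p)"

definition lie_bracket :: "'a vfield \<Rightarrow> 'a vfield \<Rightarrow> 'a vfield" where
  "lie_bracket X Y = (\<lambda>p f. X p (deriv_along Y f) - Y p (deriv_along X f))"


section \<open>Hermitian manifolds\<close>

definition riemannian_metric ::
    "('a::topological_space, 'e::euclidean_space) atlas \<Rightarrow> ('a \<Rightarrow> 'a tvec \<Rightarrow> 'a tvec \<Rightarrow> real) \<Rightarrow> bool"
  where
  "riemannian_metric A g \<longleftrightarrow>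
     (\<forall>p. bilinear_within (tangent_space A p) (g p) \<and>
          (\<forall>u\<in>tangent_space A p. \<forall>v\<in>tangent_space A p. g p u v = g p v u) \<and>
          (\<forall>v\<in>tangent_space A p. v \<noteq> 0 \<longrightarrow> g p v v > 0)) \<and>
     (\<forall>X\<in>vector_fields A. \<forall>Y\<in>vector_fields A. (\<lambda>p. g p (X p) (Y p)) \<in> smooth_functions A)"

definition apply_endo :: "('a \<Rightarrow> 'a tvec \<Rightarrow> 'a tvec) \<Rightarrow> 'a vfield \<Rightarrow> 'a vfield" where
  "apply_endo J X = (\<lambda>p. J p (X p))"

definition almost_complex_structure ::
    "('a::topological_space, 'e::euclidean_space) atlas \<Rightarrow> ('a \<Rightarrow> 'a tvec \<Rightarrow> 'a tvec) \<Rightarrow> bool"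
  where
  "almost_complex_structure A J \<longleftrightarrow>
     (\<forall>p. linear_within (tangent_space A p) (J p) \<and>
          (\<forall>v\<in>tangent_space A p. J p v \<in> tangent_space A p \<and> J p (J p v) = - v)) \<and>
     (\<forall>X\<in>vector_fields A. apply_endo J X \<in> vector_fields A)"

text \<open>Integrability is the vanishing of the Nijenhuis tensor.\<close>

definition nijenhuis ::
    "('a \<Rightarrow> 'a tvec \<Rightarrow> 'a tvec) \<Rightarrow> 'a vfield \<Rightarrow> 'a vfield \<Rightarrow> 'a vfield" where
  "nijenhuis J X Y =
     lie_bracket (apply_endo J X) (apply_endo J Y)
     - apply_endo J (lie_bracket (apply_endo J X) Y)
     - apply_endo J (lie_bracket X (apply_endo J Y))
     - lie_bracket X Y"

definition integrable_acs ::
    "('a::topological_space, 'e::euclidean_space) atlas \<Rightarrow> ('a \<Rightarrow> 'a tvec \<Rightarrow> 'a tvec) \<Rightarrow> bool"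
  where
  "integrable_acs A J \<longleftrightarrow> (\<forall>X\<in>vector_fields A. \<forall>Y\<in>vector_fields A. nijenhuis J X Y = 0)"

definition hermitian_manifold ::
    "('a::{t2_space, second_countable_topology}, 'e::euclidean_space) atlas \<Rightarrow>
     ('a \<Rightarrow> 'a tvec \<Rightarrow> 'a tvec \<Rightarrow> real) \<Rightarrow> ('a \<Rightarrow> 'a tvec \<Rightarrow> 'a tvec) \<Rightarrow> bool" where
  "hermitian_manifold A g J \<longleftrightarrow>
     connected_smooth_manifold A \<and> riemannian_metric A g \<and>
     almost_complex_structure A J \<and> integrable_acs A J \<and>
     (\<forall>p. \<forall>u\<in>tangent_space A p. \<forall>v\<in>tangent_space A p. g p (J p u) (J p v) = g p u v)"


section \<open>Connections with torsion\<close>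

text \<open>
  An affine connection is an operator \<open>D X Y\<close>; its values
  matter only on smooth vector fields.
\<close>

type_synonym 'a connection = "'a vfield \<Rightarrow> 'a vfield \<Rightarrow> 'a vfield"

definition affine_connection ::
    "('a::topological_space, 'e::euclidean_space) atlas \<Rightarrow> 'a connection \<Rightarrow> bool" where
  "affine_connection A D \<longleftrightarrow>
     (\<forall>X\<in>vector_fields A. \<forall>Y\<in>vector_fields A.
        D X Y \<in> vector_fields A \<and>
        (\<forall>Z\<in>vector_fields A. D (X + Y) Z = D X Z + D Y Z \<and> D Z (X + Y) = D Z X + D Z Y) \<and>
        (\<forall>f\<in>smooth_functions A.
           D (fmult f X) Y = fmult f (D X Y) \<and>
           D X (fmult f Y) = fmult (deriv_along X f) Y + fmult f (D X Y)))"

definition torsion :: "'a connection \<Rightarrow> 'a vfield \<Rightarrow> 'a vfield \<Rightarrow> 'a vfield" where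
  "torsion D X Y = D X Y - D Y X - lie_bracket X Y"

definition torsion3 ::
    "('a \<Rightarrow> 'a tvec \<Rightarrow> 'a tvec \<Rightarrow> real) \<Rightarrow> 'a connection \<Rightarrow>
     'a vfield \<Rightarrow> 'a vfield \<Rightarrow> 'a vfield \<Rightarrow> 'a \<Rightarrow> real" where
  "torsion3 g D X Y Z = (\<lambda>p. g p (torsion D X Y p) (Z p))"

text \<open>
  The connection \<open>\<nabla>\<^sup>a\<close>: metric, Hermitian, with totally skew-symmetric torsion. It is
  uniquely determined on smooth vector fields by these conditions. The torsion is always a
  tensor and skew in its first two arguments, so it is a 3-form iff it is also skew in its last two.
\<close>

definition skew_torsion_hermitian_connection ::
    "('a::topological_space, 'e::euclidean_space) atlas \<Rightarrow>
     ('a \<Rightarrow> 'a tvec \<Rightarrow> 'a tvec \<Rightarrow> real) \<Rightarrow> ('a \<Rightarrow> 'a tvec \<Rightarrow> 'a tvec) \<Rightarrow> 'a connection \<Rightarrow> bool" where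
  "skew_torsion_hermitian_connection A g J D \<longleftrightarrow>
     affine_connection A D \<and>
     (\<forall>X\<in>vector_fields A. \<forall>Y\<in>vector_fields A. \<forall>Z\<in>vector_fields A. \<forall>p.
        X p (\<lambda>q. g q (Y q) (Z q)) = g p (D X Y p) (Z p) + g p (Y p) (D X Z p)) \<and>
     (\<forall>X\<in>vector_fields A. \<forall>Y\<in>vector_fields A. D X (apply_endo J Y) = apply_endo J (D X Y)) \<and>
     (\<forall>X\<in>vector_fields A. \<forall>Y\<in>vector_fields A. \<forall>Z\<in>vector_fields A.
        torsion3 g D X Y Z = - torsion3 g D X Z Y)"

text \<open>The covariant derivative of a covariant 3-tensor \<open>S\<close> given by its values on vector fields.\<close>

definition cov_deriv3 ::
    "'a connection \<Rightarrow> ('a vfield \<Rightarrow> 'a vfield \<Rightarrow> 'a vfield \<Rightarrow> 'a \<Rightarrow> real) \<Rightarrow>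
     'a vfield \<Rightarrow> 'a vfield \<Rightarrow> 'a vfield \<Rightarrow> 'a vfield \<Rightarrow> 'a \<Rightarrow> real" where
  "cov_deriv3 D S X Y Z W =
     deriv_along X (S Y Z W) - S (D X Y) Z W - S Y (D X Z) W - S Y Z (D X W)"


section \<open>Holonomy reduction\<close>

definition smooth_sections ::
    "('a::topological_space, 'e::euclidean_space) atlas \<Rightarrow> ('a \<Rightarrow> 'a tvec set) \<Rightarrow> 'a vfield set"
  where
  "smooth_sections A H = {X \<in> vector_fields A. \<forall>p. X p \<in> H p}"

text \<open>
  \<open>TM = H \<oplus> V\<close> as smooth vector bundles of real ranks \<open>r\<close> and \<open>s\<close>: a pointwise direct sum for
  which every smooth vector field has smooth components (equivalently, the projections, and hence
  the subbundles, are smooth).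
\<close>

definition smooth_splitting ::
    "('a::topological_space, 'e::euclidean_space) atlas \<Rightarrow> nat \<Rightarrow> nat \<Rightarrow>
     ('a \<Rightarrow> 'a tvec set) \<Rightarrow> ('a \<Rightarrow> 'a tvec set) \<Rightarrow> bool" where
  "smooth_splitting A r s H V \<longleftrightarrow>
     (\<forall>p. subspace (H p) \<and> subspace (V p) \<and> dim (H p) = r \<and> dim (V p) = s \<and>
          H p \<inter> V p = {0} \<and> {u + v |u v. u \<in> H p \<and> v \<in> V p} = tangent_space A p) \<and>
     (\<forall>X\<in>vector_fields A. \<exists>Y\<in>smooth_sections A H. \<exists>Z\<in>smooth_sections A V. X = Y + Z)"

definition parallel_distribution ::
    "('a::topological_space, 'e::euclidean_space) atlas \<Rightarrow> 'a connection \<Rightarrow> ('a \<Rightarrow> 'a tvec set) \<Rightarrow> bool"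
  where
  "parallel_distribution A D H \<longleftrightarrow>
     (\<forall>X\<in>vector_fields A. \<forall>Y\<in>smooth_sections A H. D X Y \<in> smooth_sections A H)"

text \<open>
  The holonomy of \<open>D\<close> is contained in \<open>U(m) \<times> U(1)\<close>, with corresponding splitting
  \<open>TM = H \<oplus> V\<close>.
\<close>

definition holonomy_splitting_Um_U1 ::
    "('a::topological_space, 'e::euclidean_space) atlas \<Rightarrow>
     ('a \<Rightarrow> 'a tvec \<Rightarrow> 'a tvec \<Rightarrow> real) \<Rightarrow> ('a \<Rightarrow> 'a tvec \<Rightarrow> 'a tvec) \<Rightarrow> 'a connection \<Rightarrow> nat \<Rightarrow>
     ('a \<Rightarrow> 'a tvec set) \<Rightarrow> ('a \<Rightarrow> 'a tvec set) \<Rightarrow> bool" where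
  "holonomy_splitting_Um_U1 A g J D m H V \<longleftrightarrow>
     smooth_splitting A (2 * m) 2 H V \<and>
     (\<forall>p. \<forall>u\<in>H p. \<forall>v\<in>V p. g p u v = 0) \<and>
     (\<forall>p. (\<forall>u\<in>H p. J p u \<in> H p) \<and> (\<forall>v\<in>V p. J p v \<in> V p)) \<and>
     parallel_distribution A D H \<and> parallel_distribution A D V"


section \<open>Complex forms on the summands of a tangent space\<close>

text \<open>
  Complex-valued real-multilinear forms on a real vector space \<open>T\<close> (equivalently,
  complex-multilinear forms on its complexification), with a complex structure \<open>j\<close> on \<open>T\<close>.
  The forms below live on one summand of \<open>T\<close>, and are extended by zero on the complementary
  summand \<open>K\<close>. Being of type \<open>(k,0)\<close> or \<open>(0,k)\<close> means being complex linear or antilinear with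
  respect to \<open>j\<close>, i.e. \<open>\<alpha>(j u, \<dots>) = \<epsilon> \<alpha>(u, \<dots>)\<close> with \<open>\<epsilon> = \<i>\<close> or
  \<open>\<epsilon> = - \<i>\<close>. Values outside \<open>T\<close> are irrelevant.
\<close>

definition one_forms ::
    "complex \<Rightarrow> 'v::real_vector set \<Rightarrow> 'v set \<Rightarrow> ('v \<Rightarrow> 'v) \<Rightarrow> ('v \<Rightarrow> complex) set" where
  "one_forms \<epsilon> T K j =
     {\<beta>. linear_within T \<beta> \<and> (\<forall>v\<in>K. \<beta> v = 0) \<and> (\<forall>v\<in>T. \<beta> (j v) = \<epsilon> * \<beta> v)}"

definition two_forms ::
    "complex \<Rightarrow> 'v::real_vector set \<Rightarrow> 'v set \<Rightarrow> ('v \<Rightarrow> 'v) \<Rightarrow> ('v \<Rightarrow> 'v \<Rightarrow> complex) set" where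
  "two_forms \<epsilon> T K j =
     {\<alpha>. bilinear_within T \<alpha> \<and> (\<forall>u\<in>T. \<alpha> u u = 0) \<and>
         (\<forall>u\<in>K. \<forall>v\<in>T. \<alpha> u v = 0) \<and> (\<forall>u\<in>T. \<forall>v\<in>T. \<alpha> (j u) v = \<epsilon> * \<alpha> u v)}"

abbreviation "Lambda10 \<equiv> one_forms \<i>"
abbreviation "Lambda01 \<equiv> one_forms (- \<i>)"
abbreviation "Lambda20 \<equiv> two_forms \<i>"
abbreviation "Lambda02 \<equiv> two_forms (- \<i>)"

definition wedge21 ::
    "('v \<Rightarrow> 'v \<Rightarrow> complex) \<Rightarrow> ('v \<Rightarrow> complex) \<Rightarrow> 'v \<Rightarrow> 'v \<Rightarrow> 'v \<Rightarrow> complex" where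
  "wedge21 \<alpha> \<beta> = (\<lambda>u v w. \<alpha> u v * \<beta> w + \<alpha> v w * \<beta> u + \<alpha> w u * \<beta> v)"

text \<open>
  The image of \<open>E \<otimes> F\<close> under the wedge product. The \<open>E\<close> and \<open>F\<close> used here are closed under
  multiplication by complex scalars, so the real span is also the complex span.
\<close>

definition tensor_forms ::
    "('v \<Rightarrow> 'v \<Rightarrow> complex) set \<Rightarrow> ('v \<Rightarrow> complex) set \<Rightarrow> ('v \<Rightarrow> 'v \<Rightarrow> 'v \<Rightarrow> complex) set" where
  "tensor_forms E F = span {wedge21 \<alpha> \<beta> |\<alpha> \<beta>. \<alpha> \<in> E \<and> \<beta> \<in> F}"

text \<open>
  At every point \<open>p\<close> the torsion 3-form lies in the fibre of
  \<open>\<Lambda>\<^sup>2\<^sup>,\<^sup>0H* \<otimes> \<Lambda>\<^sup>0\<^sup>,\<^sup>1V* \<oplus> \<Lambda>\<^sup>0\<^sup>,\<^sup>2H* \<otimes> \<Lambda>\<^sup>1\<^sup>,\<^sup>0V*\<close>.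
\<close>

definition torsion_type_condition ::
    "('a::topological_space, 'e::euclidean_space) atlas \<Rightarrow>
     ('a \<Rightarrow> 'a tvec \<Rightarrow> 'a tvec \<Rightarrow> real) \<Rightarrow> ('a \<Rightarrow> 'a tvec \<Rightarrow> 'a tvec) \<Rightarrow> 'a connection \<Rightarrow>
     ('a \<Rightarrow> 'a tvec set) \<Rightarrow> ('a \<Rightarrow> 'a tvec set) \<Rightarrow> bool" where
  "torsion_type_condition A g J D H V \<longleftrightarrow>
     (\<forall>p. let T = tangent_space A p in
        \<exists>\<omega>\<^sub>1 \<in> tensor_forms (Lambda20 T (V p) (J p)) (Lambda01 T (H p) (J p)).
        \<exists>\<omega>\<^sub>2 \<in> tensor_forms (Lambda02 T (V p) (J p)) (Lambda10 T (H p) (J p)).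
        \<forall>X\<in>vector_fields A. \<forall>Y\<in>vector_fields A. \<forall>Z\<in>vector_fields A.
          complex_of_real (torsion3 g D X Y Z p) =
            \<omega>\<^sub>1 (X p) (Y p) (Z p) + \<omega>\<^sub>2 (X p) (Y p) (Z p))"

end

theory Submission
  imports Defs
begin

text \<open>
  Write \<open>F(X;Y,Z,W) = (\<nabla>\<^sup>a\<^sub>X T)(Y,Z,W)\<close>. As the splitting and \<open>J\<close> are parallel, \<open>F\<close> has
  the type of \<open>T\<close> in \<open>Y,Z,W\<close>, so only \<open>Y,Z \<in> H\<close>, \<open>W \<in> V\<close> matter. The first Bianchi
  identity \<open>\<Sum> R(X,Y)Z = \<Sum> ((\<nabla>\<^sup>a\<^sub>X T)(Y,Z) + T(T(X,Y),Z))\<close> (cyclic sums) is read off on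
  components, on which the quadratic terms drop out.

  On \<open>(H,H,H)\<close> with values in \<open>V\<close> it says that the cyclic sum of \<open>F(X;Y,Z,W)\<close> over
  \<open>X,Y,Z\<close> vanishes, which forces \<open>F\<close> to be of type \<open>(3,0) + (0,3)\<close> in \<open>X,Y,Z\<close>. On
  \<open>(H,H,V)\<close> with values in \<open>H\<close> it expresses \<open>F(Z;X,Y,W)\<close> through
  \<open>R(Y,W,X,Z)\<close> and \<open>R(W,X,Y,Z)\<close>, which are of type \<open>(1,1)\<close> in their last two
  arguments because \<open>R\<close> commutes with \<open>J\<close>; hence \<open>F(Z;X,Y,W) = 0\<close>. On \<open>(H,H,V)\<close> with
  values in \<open>V\<close> it yields \<open>F(W;X,Y,W) = R(X,Y,W,W) = 0\<close>, and together with the type of \<open>F\<close>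
  also \<open>F(JW;X,Y,W) = 0\<close>. Since \<open>V\<close> is spanned by \<open>W\<close> and \<open>JW\<close> where \<open>W \<noteq> 0\<close>,
  this is the remaining component.
\<close>

section \<open>The algebra of smooth functions\<close>

lemma frechet_derivative_cong_open:
  assumes "open S" "x \<in> S" "\<And>y. y \<in> S \<Longrightarrow> f y = h y"
  shows "frechet_derivative f (at x) = frechet_derivative h (at x)"
proof -
  have "(f has_derivative F) (at x) \<longleftrightarrow> (h has_derivative F) (at x)" for F
    using assms by (metis has_derivative_transform_within_open)
  then show ?thesis unfolding frechet_derivative_def by simp
qed

lemma differentiable_cong_open:
  assumes "open S" "x \<in> S" "\<And>y. y \<in> S \<Longrightarrow> f y = h y"
  shows "f differentiable (at x) \<longleftrightarrow> h differentiable (at x)"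
  unfolding differentiable_def using assms by (metis has_derivative_transform_within_open)

text \<open>Since \<open>S\<close> is open, a Frechet derivative at a point of \<open>S\<close> sees
  only values on \<open>S\<close>. Derivative formulas valid only there can therefore be
  substituted.\<close>

lemma Ck_on_cong:
  assumes "open S" "\<And>y. y \<in> S \<Longrightarrow> f y = h y"
  shows "Ck_on k S f \<longleftrightarrow> Ck_on k S h"
  using assms(2)
proof (induction k arbitrary: f h)
  case 0
  then show ?case by (auto cong: continuous_on_cong)
next
  case (Suc k)
  have "Ck_on k S (\<lambda>x. frechet_derivative f (at x) v) \<longleftrightarrow>
        Ck_on k S (\<lambda>x. frechet_derivative h (at x) v)" for v
    by (rule Suc.IH) (use frechet_derivative_cong_open[OF assms(1) _ Suc.prems] in auto)
  moreover have "f differentiable (at x) \<longleftrightarrow> h differentiable (at x)" if "x \<in> S" for x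
    using differentiable_cong_open[OF assms(1) that Suc.prems] .
  ultimately show ?case by auto
qed

lemma Ck_on_Suc: "Ck_on (Suc k) S f \<Longrightarrow> Ck_on k S f"
proof (induction k arbitrary: f)
  case 0
  then show ?case
    by (auto intro!: differentiable_imp_continuous_on
        simp: differentiable_on_def differentiable_at_withinI)
next
  case (Suc k)
  then show ?case using Ck_on.simps(2) by blast
qed

lemma Ck_on_add:
  assumes "open S" "Ck_on k S f" "Ck_on k S h"
  shows "Ck_on k S (\<lambda>x. f x + h x)"
  using assms(2,3)
proof (induction k arbitrary: f h)
  case 0
  then show ?case by (auto intro: continuous_intros)
next
  case (Suc k)
  have "Ck_on k S (\<lambda>x. frechet_derivative (\<lambda>x. f x + h x) (at x) v)" for v
  proof -
    have "frechet_derivative (\<lambda>x. f x + h x) (at x) v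
        = frechet_derivative f (at x) v + frechet_derivative h (at x) v" if "x \<in> S" for x
    proof -
      have "((\<lambda>x. f x + h x) has_derivative
          (\<lambda>v. frechet_derivative f (at x) v + frechet_derivative h (at x) v)) (at x)"
        using Suc.prems that by (intro has_derivative_add) (simp_all flip: frechet_derivative_works)
      from fun_cong[OF frechet_derivative_at[OF this], of v] show ?thesis by simp
    qed
    then show ?thesis
      using Suc by (subst Ck_on_cong[OF assms(1)]) auto
  qed
  then show ?case using Suc.prems by simp
qed

lemma Ck_on_mult:
  fixes f h :: "'e::euclidean_space \<Rightarrow> real"
  assumes "open S" "Ck_on k S f" "Ck_on k S h"
  shows "Ck_on k S (\<lambda>x. f x * h x)"
  using assms(2,3)
proof (induction k arbitrary: f h)
  case 0
  then show ?case by (auto intro: continuous_intros)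
next
  case (Suc k)
  have "Ck_on k S (\<lambda>x. frechet_derivative (\<lambda>x. f x * h x) (at x) v)" for v
  proof -
    have "frechet_derivative (\<lambda>x. f x * h x) (at x) v
        = f x * frechet_derivative h (at x) v + frechet_derivative f (at x) v * h x"
      if "x \<in> S" for x
    proof -
      have "((\<lambda>x. f x * h x) has_derivative
          (\<lambda>v. f x * frechet_derivative h (at x) v + frechet_derivative f (at x) v * h x)) (at x)"
        using Suc.prems that by (intro has_derivative_mult) (simp_all flip: frechet_derivative_works)
      from fun_cong[OF frechet_derivative_at[OF this], of v] show ?thesis by simp
    qed
    \<comment> \<open>The product rule multiplies an undifferentiated factor by a derivative, so
      each factor is also needed one order lower.\<close>
    moreover have "Ck_on k S
        (\<lambda>x. f x * frechet_derivative h (at x) v + frechet_derivative f (at x) v * h x)"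
      using Suc.prems Ck_on_Suc[of k S f] Ck_on_Suc[of k S h]
      by (intro Ck_on_add Suc.IH assms(1)) auto
    ultimately show ?thesis
      by (subst Ck_on_cong[OF assms(1)]) auto
  qed
  then show ?case using Suc.prems by simp
qed

lemma Ck_on_const: "Ck_on k S (\<lambda>x. c)"
  by (induction k arbitrary: c) auto

lemma smooth_functions_add:
  assumes "smooth_atlas A" "f \<in> smooth_functions A" "h \<in> smooth_functions A"
  shows "f + h \<in> smooth_functions A"
  using assms unfolding smooth_functions_def smooth_on_def smooth_atlas_def
  by (auto simp: o_def case_prod_unfold intro!: Ck_on_add)

lemma smooth_functions_mult:
  assumes "smooth_atlas A" "f \<in> smooth_functions A" "h \<in> smooth_functions A"
  shows "f * h \<in> smooth_functions A"
  using assms unfolding smooth_functions_def smooth_on_def smooth_atlas_def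
  by (auto simp: o_def case_prod_unfold intro!: Ck_on_mult)

lemma smooth_functions_const: "(\<lambda>x. c) \<in> smooth_functions A"
  unfolding smooth_functions_def smooth_on_def by (auto simp: o_def Ck_on_const)

lemma smooth_functions_uminus:
  assumes "smooth_atlas A" "f \<in> smooth_functions A"
  shows "- f \<in> smooth_functions A"
proof -
  have "- f = (\<lambda>x. -1) * f" by (auto simp: fun_eq_iff)
  then show ?thesis using smooth_functions_mult[OF assms(1) smooth_functions_const assms(2)] by simp
qed

lemma smooth_functions_diff:
  assumes "smooth_atlas A" "f \<in> smooth_functions A" "h \<in> smooth_functions A"
  shows "f - h \<in> smooth_functions A"
  using smooth_functions_add[OF assms(1,2) smooth_functions_uminus[OF assms(1,3)]] by simp


section \<open>Vector fields\<close>

lemma subspace_tangent_space: "subspace (tangent_space A p)"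
  unfolding subspace_def tangent_space_def linear_within_def
  by (auto simp: scaleR_fun_def algebra_simps)

lemma vector_fields_tangent: "X \<in> vector_fields A \<Longrightarrow> X p \<in> tangent_space A p"
  by (simp add: vector_fields_def)

lemma vector_fields_fmult:
  assumes "smooth_atlas A" "f \<in> smooth_functions A" "X \<in> vector_fields A"
  shows "fmult f X \<in> vector_fields A"
proof -
  have "deriv_along (fmult f X) h = f * deriv_along X h" for h
    by (auto simp: deriv_along_def fmult_def scaleR_fun_def fun_eq_iff)
  then show ?thesis
    using assms(2,3) unfolding vector_fields_def
    by (auto simp: fmult_def smooth_functions_mult[OF assms(1)]
        intro: subspace_scale[OF subspace_tangent_space])
qed

lemma vector_fields_add:
  assumes "smooth_atlas A" "X \<in> vector_fields A" "Y \<in> vector_fields A"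
  shows "X + Y \<in> vector_fields A"
proof -
  have "deriv_along (X + Y) h = deriv_along X h + deriv_along Y h" for h
    by (auto simp: deriv_along_def fun_eq_iff)
  then show ?thesis
    using assms(2,3) unfolding vector_fields_def
    by (auto simp: smooth_functions_add[OF assms(1)]
        intro: subspace_add[OF subspace_tangent_space])
qed

lemma vector_fields_uminus:
  assumes "smooth_atlas A" "X \<in> vector_fields A"
  shows "- X \<in> vector_fields A"
proof -
  have "- X = fmult (\<lambda>x. -1) X" by (auto simp: fmult_def fun_eq_iff scaleR_fun_def)
  then show ?thesis using vector_fields_fmult[OF assms(1) smooth_functions_const assms(2)] by simp
qed

lemma vector_fields_diff:
  assumes "smooth_atlas A" "X \<in> vector_fields A" "Y \<in> vector_fields A"
  shows "X - Y \<in> vector_fields A"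
  using vector_fields_add[OF assms(1,2) vector_fields_uminus[OF assms(1,3)]] by simp

lemma vector_fields_zero:
  assumes "smooth_atlas A" "X \<in> vector_fields A"
  shows "0 \<in> vector_fields A"
  using vector_fields_diff[OF assms assms(2)] by simp

lemma tangent_add:
  "v \<in> tangent_space A p \<Longrightarrow> f \<in> smooth_functions A \<Longrightarrow> h \<in> smooth_functions A \<Longrightarrow> v (f + h) = v f + v h"
  by (auto simp: tangent_space_def linear_within_def)

lemma tangent_scale:
  "v \<in> tangent_space A p \<Longrightarrow> f \<in> smooth_functions A \<Longrightarrow> v (c *\<^sub>R f) = c * v f"
  by (auto simp: tangent_space_def linear_within_def)

lemma tangent_diff:
  assumes "smooth_atlas A" "v \<in> tangent_space A p" "f \<in> smooth_functions A" "h \<in> smooth_functions A"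
  shows "v (f - h) = v f - v h"
  using tangent_add[OF assms(2) smooth_functions_diff[OF assms(1,3,4)] assms(4)] by simp

lemma tangent_mult:
  "v \<in> tangent_space A p \<Longrightarrow> f \<in> smooth_functions A \<Longrightarrow> h \<in> smooth_functions A \<Longrightarrow>
   v (f * h) = f p * v h + h p * v f"
  by (auto simp: tangent_space_def)

lemma tangent_nonsmooth: "v \<in> tangent_space A p \<Longrightarrow> f \<notin> smooth_functions A \<Longrightarrow> v f = 0"
  by (auto simp: tangent_space_def)

lemma tangent_zero: "v \<in> tangent_space A p \<Longrightarrow> v 0 = 0"
  using tangent_scale[of v A p 0 0] tangent_nonsmooth[of v A p 0] by fastforce

lemma deriv_along_smooth:
  "X \<in> vector_fields A \<Longrightarrow> f \<in> smooth_functions A \<Longrightarrow> deriv_along X f \<in> smooth_functions A"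
  by (simp add: vector_fields_def)

lemma deriv_along_nonsmooth:
  "X \<in> vector_fields A \<Longrightarrow> f \<notin> smooth_functions A \<Longrightarrow> deriv_along X f = 0"
  by (simp add: deriv_along_def fun_eq_iff tangent_nonsmooth[OF vector_fields_tangent])

lemma deriv_along_add:
  "X \<in> vector_fields A \<Longrightarrow> f \<in> smooth_functions A \<Longrightarrow> h \<in> smooth_functions A \<Longrightarrow>
   deriv_along X (f + h) = deriv_along X f + deriv_along X h"
  by (simp add: deriv_along_def fun_eq_iff tangent_add[OF vector_fields_tangent])

lemma deriv_along_mult:
  "X \<in> vector_fields A \<Longrightarrow> f \<in> smooth_functions A \<Longrightarrow> h \<in> smooth_functions A \<Longrightarrow>
   deriv_along X (f * h) = f * deriv_along X h + h * deriv_along X f"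
  by (simp add: deriv_along_def fun_eq_iff tangent_mult[OF vector_fields_tangent])

lemma deriv_along_scale:
  "X \<in> vector_fields A \<Longrightarrow> f \<in> smooth_functions A \<Longrightarrow>
   deriv_along X (c *\<^sub>R f) = c *\<^sub>R deriv_along X f"
  by (auto simp: deriv_along_def fun_eq_iff tangent_scale[OF vector_fields_tangent]
      scaleR_fun_def[of c "\<lambda>p. X p f"])

section \<open>The Lie bracket and the Jacobi identity\<close>

lemma deriv_along_lie_bracket:
  "deriv_along (lie_bracket X Y) f = deriv_along X (deriv_along Y f) - deriv_along Y (deriv_along X f)"
  by (auto simp: deriv_along_def lie_bracket_def fun_eq_iff)

lemma vector_fields_lie_bracket:
  assumes A: "smooth_atlas A" and X: "X \<in> vector_fields A" and Y: "Y \<in> vector_fields A"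
  shows "lie_bracket X Y \<in> vector_fields A"
proof -
  note Xp = vector_fields_tangent[OF X] and Yp = vector_fields_tangent[OF Y]
  note sm = deriv_along_smooth[OF X] deriv_along_smooth[OF Y]
  have "lie_bracket X Y p \<in> tangent_space A p" for p
    unfolding tangent_space_def linear_within_def mem_Collect_eq lie_bracket_def
  proof (intro conjI ballI allI impI)
    fix f h assume f: "f \<in> smooth_functions A" and h: "h \<in> smooth_functions A"
    show "X p (deriv_along Y (f + h)) - Y p (deriv_along X (f + h)) =
        X p (deriv_along Y f) - Y p (deriv_along X f) + (X p (deriv_along Y h) - Y p (deriv_along X h))"
      using f h by (simp add: deriv_along_add[OF X] deriv_along_add[OF Y]
          tangent_add[OF Xp] tangent_add[OF Yp] sm)
    \<comment> \<open>Both second derivatives of \<open>f * h\<close> contain the same mixed terms,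
      X f times Y h plus X h times Y f; these cancel.\<close>
    show "X p (deriv_along Y (f * h)) - Y p (deriv_along X (f * h)) =
        f p * (X p (deriv_along Y h) - Y p (deriv_along X h)) +
        h p * (X p (deriv_along Y f) - Y p (deriv_along X f))"
      using f h by (simp add: deriv_along_mult[OF X] deriv_along_mult[OF Y]
          tangent_add[OF Xp] tangent_add[OF Yp] tangent_mult[OF Xp] tangent_mult[OF Yp] sm
          smooth_functions_mult[OF A]) (simp add: deriv_along_def algebra_simps)
  next
    fix c f assume f: "f \<in> smooth_functions A"
    show "X p (deriv_along Y (c *\<^sub>R f)) - Y p (deriv_along X (c *\<^sub>R f)) =
        c *\<^sub>R (X p (deriv_along Y f) - Y p (deriv_along X f))"
      using f by (simp add: deriv_along_scale[OF X] deriv_along_scale[OF Y]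
          tangent_scale[OF Xp] tangent_scale[OF Yp] sm algebra_simps)
  next
    fix f assume "f \<notin> smooth_functions A"
    \<comment> \<open>Both inner derivatives are the zero function, which every tangent vector sends
      to 0.\<close>
    then show "X p (deriv_along Y f) - Y p (deriv_along X f) = 0"
      by (simp add: deriv_along_nonsmooth[OF X] deriv_along_nonsmooth[OF Y]
          tangent_zero[OF Xp] tangent_zero[OF Yp])
  qed
  moreover have "deriv_along (lie_bracket X Y) f \<in> smooth_functions A" if "f \<in> smooth_functions A" for f
    using that by (simp add: deriv_along_lie_bracket sm smooth_functions_diff[OF A])
  ultimately show ?thesis by (simp add: vector_fields_def)
qed

lemma lie_bracket_skew: "lie_bracket X Y = - lie_bracket Y X"
  by (auto simp: lie_bracket_def fun_eq_iff)

lemma jacobi_identity: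
  assumes A: "smooth_atlas A"
    and X: "X \<in> vector_fields A" and Y: "Y \<in> vector_fields A" and Z: "Z \<in> vector_fields A"
  shows "lie_bracket X (lie_bracket Y Z) + lie_bracket Y (lie_bracket Z X)
    + lie_bracket Z (lie_bracket X Y) = 0"
proof (intro ext)
  fix p f
  show "(lie_bracket X (lie_bracket Y Z) + lie_bracket Y (lie_bracket Z X)
    + lie_bracket Z (lie_bracket X Y)) p f = 0 p f"
  proof (cases "f \<in> smooth_functions A")
    case True
    then show ?thesis
      by (simp add: lie_bracket_def[of X "lie_bracket Y Z"] lie_bracket_def[of Y "lie_bracket Z X"]
          lie_bracket_def[of Z "lie_bracket X Y"] deriv_along_lie_bracket
          tangent_diff[OF A vector_fields_tangent[OF X]] tangent_diff[OF A vector_fields_tangent[OF Y]]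
          tangent_diff[OF A vector_fields_tangent[OF Z]]
          deriv_along_smooth[OF X] deriv_along_smooth[OF Y] deriv_along_smooth[OF Z])
        (simp add: lie_bracket_def)
  next
    case False
    \<comment> \<open>Tangent vectors are extended by zero off the smooth functions, and brackets
      are again vector fields.\<close>
    have "lie_bracket U W p f = 0" if "U \<in> vector_fields A" "W \<in> vector_fields A" for U W
      using False vector_fields_tangent[OF vector_fields_lie_bracket[OF A that]]
      by (rule tangent_nonsmooth[rotated])
    then show ?thesis by (simp add: X Y Z vector_fields_lie_bracket[OF A])
  qed
qed

section \<open>Curvature and the first Bianchi identity\<close>

lemma lie_bracket_add_left:
  assumes "X \<in> vector_fields A" "Y \<in> vector_fields A" "Z \<in> vector_fields A"
  shows "lie_bracket (X + Y) Z = lie_bracket X Z + lie_bracket Y Z"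
proof (intro ext)
  fix p f
  have eq: "deriv_along (X + Y) f = deriv_along X f + deriv_along Y f"
    by (simp add: deriv_along_def fun_eq_iff)
  have "Z p (deriv_along X f + deriv_along Y f) = Z p (deriv_along X f) + Z p (deriv_along Y f)"
  proof (cases "f \<in> smooth_functions A")
    case True
    then show ?thesis
      using assms by (intro tangent_add[OF vector_fields_tangent[of Z A]] deriv_along_smooth) auto
  next
    case False
    then show ?thesis
      using assms by (simp add: deriv_along_nonsmooth tangent_zero[OF vector_fields_tangent[of Z A]])
  qed
  then show "lie_bracket (X + Y) Z p f = (lie_bracket X Z + lie_bracket Y Z) p f"
    by (simp add: lie_bracket_def eq)
qed

definition curvature :: "'a connection \<Rightarrow> 'a vfield \<Rightarrow> 'a vfield \<Rightarrow> 'a vfield \<Rightarrow> 'a vfield" where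
  "curvature D X Y Z = D X (D Y Z) - D Y (D X Z) - D (lie_bracket X Y) Z"

text \<open>The vector-valued form, because the Bianchi identity involves no metric;
  \<open>F_G\<close> later relates it to \<open>cov_deriv3\<close>.\<close>

definition cov_deriv_torsion :: "'a connection \<Rightarrow> 'a vfield \<Rightarrow> 'a vfield \<Rightarrow> 'a vfield \<Rightarrow> 'a vfield" where
  "cov_deriv_torsion D X Y Z = D X (torsion D Y Z) - torsion D (D X Y) Z - torsion D Y (D X Z)"

locale manifold_connection =
  fixes A :: "('a::{t2_space, second_countable_topology}, 'e::euclidean_space) atlas"
    and D :: "'a connection"
  assumes atlas: "smooth_atlas A" and affine: "affine_connection A D"
begin

abbreviation "VF \<equiv> vector_fields A"

lemma D_VF [simp]: "X \<in> VF \<Longrightarrow> Y \<in> VF \<Longrightarrow> D X Y \<in> VF"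
  using affine by (auto simp: affine_connection_def)

lemmas VF_closed [simp] =
  vector_fields_add[OF atlas] vector_fields_diff[OF atlas] vector_fields_uminus[OF atlas]
  vector_fields_lie_bracket[OF atlas] vector_fields_fmult[OF atlas]

lemma D_add_left: "X \<in> VF \<Longrightarrow> Y \<in> VF \<Longrightarrow> Z \<in> VF \<Longrightarrow> D (X + Y) Z = D X Z + D Y Z"
  using affine unfolding affine_connection_def by blast

lemma D_add_right: "X \<in> VF \<Longrightarrow> Y \<in> VF \<Longrightarrow> Z \<in> VF \<Longrightarrow> D Z (X + Y) = D Z X + D Z Y"
  using affine unfolding affine_connection_def by blast

lemma D_diff_right:
  assumes "X \<in> VF" "Y \<in> VF" "Z \<in> VF"
  shows "D Z (X - Y) = D Z X - D Z Y"
  using D_add_right[of "X - Y" Y Z] assms by simp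

lemma D_fmult_left:
  "X \<in> VF \<Longrightarrow> Y \<in> VF \<Longrightarrow> f \<in> smooth_functions A \<Longrightarrow> D (fmult f X) Y = fmult f (D X Y)"
  using affine unfolding affine_connection_def by blast

lemma torsion_VF [simp]: "X \<in> VF \<Longrightarrow> Y \<in> VF \<Longrightarrow> torsion D X Y \<in> VF"
  by (simp add: torsion_def)

lemma torsion_skew: "torsion D X Y = - torsion D Y X"
  by (simp add: torsion_def lie_bracket_skew[of X Y])

lemma torsion_add_left:
  "X \<in> VF \<Longrightarrow> Y \<in> VF \<Longrightarrow> Z \<in> VF \<Longrightarrow> torsion D (X + Y) Z = torsion D X Z + torsion D Y Z"
  by (simp add: torsion_def D_add_left D_add_right lie_bracket_add_left[of X A Y Z])

lemma torsion_diff_left: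
  assumes "X \<in> VF" "Y \<in> VF" "Z \<in> VF"
  shows "torsion D (X - Y) Z = torsion D X Z - torsion D Y Z"
  using torsion_add_left[of "X - Y" Y Z] assms by simp

text \<open>Expanding with \<open>ct\<close> and \<open>tt\<close>, the torsions of covariant
  derivatives cancel in the cyclic sum. The remaining second derivatives and derivatives along
  brackets form the curvature, and the double brackets vanish by Jacobi.\<close>

lemma first_bianchi:
  assumes [simp]: "X \<in> VF" "Y \<in> VF" "Z \<in> VF"
  shows "curvature D X Y Z + curvature D Y Z X + curvature D Z X Y =
    (cov_deriv_torsion D X Y Z + cov_deriv_torsion D Y Z X + cov_deriv_torsion D Z X Y) +
    (torsion D (torsion D X Y) Z + torsion D (torsion D Y Z) X + torsion D (torsion D Z X) Y)"
proof -
  have tt: "torsion D (torsion D U W) S = torsion D (D U W) S - torsion D (D W U) S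
      - (D (lie_bracket U W) S - D S (lie_bracket U W) + lie_bracket S (lie_bracket U W))"
    if "U \<in> VF" "W \<in> VF" "S \<in> VF" for U W S
  proof -
    have "torsion D (torsion D U W) S
        = torsion D (D U W) S - torsion D (D W U) S - torsion D (lie_bracket U W) S"
      using that by (simp add: torsion_def[of D U W] torsion_diff_left)
    moreover have "torsion D (lie_bracket U W) S
        = D (lie_bracket U W) S - D S (lie_bracket U W) + lie_bracket S (lie_bracket U W)"
      by (simp add: torsion_def lie_bracket_skew[of "lie_bracket U W"])
    ultimately show ?thesis by simp
  qed
  have ct: "cov_deriv_torsion D U W S = D U (D W S) - D U (D S W) - D U (lie_bracket W S)
      - torsion D (D U W) S + torsion D (D U S) W"
    if "U \<in> VF" "W \<in> VF" "S \<in> VF" for U W S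
    using that torsion_skew[of W "D U S"]
    by (simp add: cov_deriv_torsion_def torsion_def[of D W S] D_diff_right)
  have jac: "lie_bracket Z (lie_bracket X Y) =
      - lie_bracket X (lie_bracket Y Z) - lie_bracket Y (lie_bracket Z X)"
    using jacobi_identity[OF atlas assms]
    by (simp only: eq_diff_eq eq_neg_iff_add_eq_0 ac_simps)
  show ?thesis
    by (simp add: curvature_def tt ct jac)
qed

end


section \<open>Hermitian connections with skew torsion\<close>

locale skew_torsion_splitting =
  fixes A :: "('a::{t2_space, second_countable_topology}, 'e::euclidean_space) atlas"
    and g :: "'a \<Rightarrow> 'a tvec \<Rightarrow> 'a tvec \<Rightarrow> real"
    and J :: "'a \<Rightarrow> 'a tvec \<Rightarrow> 'a tvec"
    and D :: "'a connection"
    and H V :: "'a \<Rightarrow> 'a tvec set"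
    and m :: nat
  assumes herm: "hermitian_manifold A g J"
    and conn: "skew_torsion_hermitian_connection A g J D"
    and hol: "holonomy_splitting_Um_U1 A g J D m H V"
    and tor: "torsion_type_condition A g J D H V"
begin

sublocale manifold_connection A D
  using herm conn
  by unfold_locales
    (auto simp: hermitian_manifold_def connected_smooth_manifold_def
      skew_torsion_hermitian_connection_def)

abbreviation "HF \<equiv> smooth_sections A H"
abbreviation "VV \<equiv> smooth_sections A V"
abbreviation "JJ \<equiv> apply_endo J"
abbreviation "T \<equiv> tangent_space A"

section \<open>Metric and complex structure on vector fields\<close>

definition G :: "'a vfield \<Rightarrow> 'a vfield \<Rightarrow> 'a \<Rightarrow> real" where
  "G X Y = (\<lambda>p. g p (X p) (Y p))"

lemma riem: "riemannian_metric A g" and acs: "almost_complex_structure A J"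
  and gJ: "u \<in> T p \<Longrightarrow> v \<in> T p \<Longrightarrow> g p (J p u) (J p v) = g p u v"
  using herm by (auto simp: hermitian_manifold_def)

lemma VF_T [simp]: "X \<in> VF \<Longrightarrow> X p \<in> T p"
  by (rule vector_fields_tangent)

lemma T_closed [simp]:
  "u \<in> T p \<Longrightarrow> v \<in> T p \<Longrightarrow> u + v \<in> T p" "u \<in> T p \<Longrightarrow> v \<in> T p \<Longrightarrow> u - v \<in> T p"
  "u \<in> T p \<Longrightarrow> - u \<in> T p" "u \<in> T p \<Longrightarrow> c *\<^sub>R u \<in> T p" "0 \<in> T p"
  by (auto intro: subspace_add subspace_diff subspace_neg subspace_scale subspace_0
      simp: subspace_tangent_space)

lemma g_add_left: "u \<in> T p \<Longrightarrow> v \<in> T p \<Longrightarrow> w \<in> T p \<Longrightarrow> g p (u + v) w = g p u w + g p v w"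
  and g_scale_left: "u \<in> T p \<Longrightarrow> w \<in> T p \<Longrightarrow> g p (c *\<^sub>R u) w = c * g p u w"
  and g_sym: "u \<in> T p \<Longrightarrow> w \<in> T p \<Longrightarrow> g p u w = g p w u"
  and g_pos: "u \<in> T p \<Longrightarrow> u \<noteq> 0 \<Longrightarrow> g p u u > 0"
  using riem by (auto simp: riemannian_metric_def bilinear_within_def linear_within_def)

lemma g_zero: "u \<in> T p \<Longrightarrow> g p 0 u = 0" "u \<in> T p \<Longrightarrow> g p u 0 = 0"
  using g_scale_left[of 0 p u 0] g_sym[of u p 0] by auto

lemma G_smooth [simp]: "X \<in> VF \<Longrightarrow> Y \<in> VF \<Longrightarrow> G X Y \<in> smooth_functions A"
  using riem by (auto simp: G_def riemannian_metric_def)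

lemma G_sym: "X \<in> VF \<Longrightarrow> Y \<in> VF \<Longrightarrow> G X Y = G Y X"
  by (auto simp: G_def fun_eq_iff intro: g_sym)

lemma G_add_left: "X \<in> VF \<Longrightarrow> Y \<in> VF \<Longrightarrow> Z \<in> VF \<Longrightarrow> G (X + Y) Z = G X Z + G Y Z"
  by (auto simp: G_def fun_eq_iff intro: g_add_left)

lemma G_diff_left:
  assumes "X \<in> VF" "Y \<in> VF" "Z \<in> VF" shows "G (X - Y) Z = G X Z - G Y Z"
  using G_add_left[of "X - Y" Y Z] assms by simp

lemma G_uminus_left:
  assumes "X \<in> VF" "Z \<in> VF" shows "G (- X) Z = - G X Z"
  using G_diff_left[of 0 X Z] G_diff_left[of X X Z] vector_fields_zero[OF atlas] assms by simp

lemma G_add_right: "X \<in> VF \<Longrightarrow> Y \<in> VF \<Longrightarrow> Z \<in> VF \<Longrightarrow> G Z (X + Y) = G Z X + G Z Y"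
  by (simp add: G_sym[of Z] G_add_left)

lemma G_uminus_right:
  assumes "X \<in> VF" "Z \<in> VF" shows "G Z (- X) = - G Z X"
  using assms by (simp add: G_sym[of Z] G_uminus_left)

lemma G_self_zero:
  assumes "X \<in> VF" "G X X p = 0" shows "X p = 0"
  using g_pos[of "X p" p] assms by (force simp: G_def)

lemma JJ_VF [simp]: "X \<in> VF \<Longrightarrow> JJ X \<in> VF"
  using acs by (auto simp: almost_complex_structure_def)

lemma J_T [simp]: "u \<in> T p \<Longrightarrow> J p u \<in> T p" and J_J [simp]: "u \<in> T p \<Longrightarrow> J p (J p u) = - u"
  using acs by (auto simp: almost_complex_structure_def)

lemma J_add: "u \<in> T p \<Longrightarrow> v \<in> T p \<Longrightarrow> J p (u + v) = J p u + J p v"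
  and J_scale: "u \<in> T p \<Longrightarrow> J p (c *\<^sub>R u) = c *\<^sub>R J p u"
  using acs by (auto simp: almost_complex_structure_def linear_within_def)

lemma apply_endo_apply: "apply_endo K X p = K p (X p)"
  by (simp add: apply_endo_def)

lemma JJ_JJ [simp]: "X \<in> VF \<Longrightarrow> JJ (JJ X) = - X"
  by (intro ext) (simp add: apply_endo_apply)

lemma JJ_add: "X \<in> VF \<Longrightarrow> Y \<in> VF \<Longrightarrow> JJ (X + Y) = JJ X + JJ Y"
  by (intro ext) (simp add: apply_endo_apply J_add)

lemma JJ_diff:
  assumes "X \<in> VF" "Y \<in> VF" shows "JJ (X - Y) = JJ X - JJ Y"
  using JJ_add[of "X - Y" Y] assms by simp

lemma G_JJ: "X \<in> VF \<Longrightarrow> Y \<in> VF \<Longrightarrow> G (JJ X) (JJ Y) = G X Y"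
  by (simp add: G_def apply_endo_def gJ)

lemma G_JJ_left: "X \<in> VF \<Longrightarrow> Y \<in> VF \<Longrightarrow> G (JJ X) Y = - G X (JJ Y)"
  using G_JJ[of X "JJ Y"] G_uminus_right[of Y "JJ X"] by (metis JJ_JJ JJ_VF add.inverse_inverse)

section \<open>The metric Hermitian connection and its curvature\<close>

lemma D_metric:
  "X \<in> VF \<Longrightarrow> Y \<in> VF \<Longrightarrow> Z \<in> VF \<Longrightarrow> deriv_along X (G Y Z) = G (D X Y) Z + G Y (D X Z)"
  using conn by (simp add: skew_torsion_hermitian_connection_def G_def deriv_along_def fun_eq_iff)

lemma D_JJ: "X \<in> VF \<Longrightarrow> Y \<in> VF \<Longrightarrow> D X (JJ Y) = JJ (D X Y)"
  using conn by (auto simp: skew_torsion_hermitian_connection_def)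

lemma torsion3_G: "torsion3 g D X Y Z = G (torsion D X Y) Z"
  by (simp add: torsion3_def G_def)

lemma torsion3_skew23:
  "X \<in> VF \<Longrightarrow> Y \<in> VF \<Longrightarrow> Z \<in> VF \<Longrightarrow> torsion3 g D X Y Z = - torsion3 g D X Z Y"
  using conn unfolding skew_torsion_hermitian_connection_def by blast

lemma torsion3_skew12:
  assumes "X \<in> VF" "Y \<in> VF" "Z \<in> VF"
  shows "torsion3 g D X Y Z = - torsion3 g D Y X Z"
  using assms G_uminus_left[of "torsion D Y X" Z] by (simp add: torsion3_G torsion_skew[of X Y])

lemma curvature_VF [simp]: "X \<in> VF \<Longrightarrow> Y \<in> VF \<Longrightarrow> Z \<in> VF \<Longrightarrow> curvature D X Y Z \<in> VF"
  by (simp add: curvature_def)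

lemma cov_deriv_torsion_VF [simp]:
  "X \<in> VF \<Longrightarrow> Y \<in> VF \<Longrightarrow> Z \<in> VF \<Longrightarrow> cov_deriv_torsion D X Y Z \<in> VF"
  by (simp add: cov_deriv_torsion_def)

lemma curvature_JJ:
  "X \<in> VF \<Longrightarrow> Y \<in> VF \<Longrightarrow> Z \<in> VF \<Longrightarrow> curvature D X Y (JJ Z) = JJ (curvature D X Y Z)"
  by (simp add: curvature_def D_JJ JJ_diff)

text \<open>Compute the derivative of \<open>G Z Z\<close> along \<open>lie_bracket X Y\<close>
  directly and as a commutator. The products of \<open>D X Z\<close> with \<open>D Y Z\<close> are
  symmetric in \<open>X\<close> and \<open>Y\<close> and cancel.\<close>

lemma curvature_metric_diag:
  assumes [simp]: "X \<in> VF" "Y \<in> VF" "Z \<in> VF"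
  shows "G (curvature D X Y Z) Z = 0"
proof -
  have d: "deriv_along U (G Z Z) = G (D U Z) Z + G (D U Z) Z" if "U \<in> VF" for U
    using that by (simp add: D_metric G_sym[of Z "D U Z"])
  have dd: "deriv_along W (deriv_along U (G Z Z)) =
     (G (D W (D U Z)) Z + G (D U Z) (D W Z)) + (G (D W (D U Z)) Z + G (D U Z) (D W Z))"
    if "U \<in> VF" "W \<in> VF" for U W
    using that by (simp only: d[OF that(1)] deriv_along_add[of W A] G_smooth D_VF assms)
      (simp only: D_metric D_VF assms)
  have "G (D (lie_bracket X Y) Z) Z p = G (D X (D Y Z)) Z p - G (D Y (D X Z)) Z p" for p
  proof -
    have "lie_bracket X Y \<in> VF" by simp
    from fun_cong[OF d[OF this], of p] fun_cong[OF dd[OF assms(2,1)], of p]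
      fun_cong[OF dd[OF assms(1,2)], of p] fun_cong[OF deriv_along_lie_bracket[of X Y "G Z Z"], of p]
      fun_cong[OF G_sym[of "D X Z" "D Y Z"], of p]
    show ?thesis by (simp only: minus_apply plus_fun_apply D_VF assms)
  qed
  then show ?thesis
    by (simp add: curvature_def G_diff_left fun_eq_iff)
qed

section \<open>The covariant derivative of the torsion form\<close>

abbreviation "F \<equiv> cov_deriv3 D (torsion3 g D)"

text \<open>By metric compatibility, differentiating the pairing with \<open>W\<close> produces a
  term in \<open>D X W\<close> that cancels the last term of \<open>cov_deriv3\<close>.\<close>

lemma F_G:
  assumes "X \<in> VF" "Y \<in> VF" "Z \<in> VF" "W \<in> VF"
  shows "F X Y Z W = G (cov_deriv_torsion D X Y Z) W"
  using assms
  by (simp add: cov_deriv3_def torsion3_G D_metric cov_deriv_torsion_def G_diff_left)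

lemma deriv_along_uminus:
  "X \<in> VF \<Longrightarrow> f \<in> smooth_functions A \<Longrightarrow> deriv_along X (- f) = - deriv_along X f"
  using deriv_along_scale[of X A f "-1"] by simp

lemma torsion3_smooth [simp]:
  "X \<in> VF \<Longrightarrow> Y \<in> VF \<Longrightarrow> Z \<in> VF \<Longrightarrow> torsion3 g D X Y Z \<in> smooth_functions A"
  by (simp add: torsion3_G)

lemma F_skew12:
  assumes "X \<in> VF" "Y \<in> VF" "Z \<in> VF" "W \<in> VF"
  shows "F X Y Z W = - F X Z Y W"
  using assms torsion3_skew12[of Y Z W] torsion3_skew12[of "D X Y" Z W]
    torsion3_skew12[of Y "D X Z" W] torsion3_skew12[of Y Z "D X W"]
  by (simp add: cov_deriv3_def deriv_along_uminus)

lemma F_skew23: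
  assumes "X \<in> VF" "Y \<in> VF" "Z \<in> VF" "W \<in> VF"
  shows "F X Y Z W = - F X Y W Z"
  using assms torsion3_skew23[of Y Z W] torsion3_skew23[of "D X Y" Z W]
    torsion3_skew23[of Y "D X Z" W] torsion3_skew23[of Y Z "D X W"]
  by (simp add: cov_deriv3_def deriv_along_uminus)

lemma F_add4:
  assumes "X \<in> VF" "Y \<in> VF" "Z \<in> VF" "W \<in> VF" "W' \<in> VF"
  shows "F X Y Z (W + W') = F X Y Z W + F X Y Z W'"
  using assms by (simp add: F_G G_add_right)

lemma torsion3_add1:
  assumes "X \<in> VF" "X' \<in> VF" "Y \<in> VF" "Z \<in> VF"
  shows "torsion3 g D (X + X') Y Z = torsion3 g D X Y Z + torsion3 g D X' Y Z"
  using assms by (simp add: torsion3_G torsion_add_left G_add_left)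

lemma torsion3_add2:
  assumes "X \<in> VF" "X' \<in> VF" "Y \<in> VF" "Z \<in> VF"
  shows "torsion3 g D Y (X + X') Z = torsion3 g D Y X Z + torsion3 g D Y X' Z"
  using assms torsion3_add1[OF assms] torsion3_skew12[of Y "X + X'" Z] torsion3_skew12[of Y X Z]
    torsion3_skew12[of Y X' Z] by simp

lemma torsion3_add3:
  assumes "X \<in> VF" "X' \<in> VF" "Y \<in> VF" "Z \<in> VF"
  shows "torsion3 g D Y Z (X + X') = torsion3 g D Y Z X + torsion3 g D Y Z X'"
  using assms by (simp add: torsion3_G G_add_right)

lemma F_add1:
  assumes [simp]: "X \<in> VF" "X' \<in> VF" "Y \<in> VF" "Z \<in> VF" "W \<in> VF"
  shows "F (X + X') Y Z W = F X Y Z W + F X' Y Z W"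
proof -
  have "deriv_along (X + X') f = deriv_along X f + deriv_along X' f" for f
    by (simp add: deriv_along_def fun_eq_iff)
  then show ?thesis
    by (simp add: cov_deriv3_def D_add_left torsion3_add1 torsion3_add2 torsion3_add3 algebra_simps)
qed


subsection \<open>The parallel splitting\<close>

lemma smooth_sections_I: "X \<in> VF \<Longrightarrow> (\<And>p. X p \<in> K p) \<Longrightarrow> X \<in> smooth_sections A K"
  by (auto simp: smooth_sections_def)

lemma HF_VF [simp]: "X \<in> HF \<Longrightarrow> X \<in> VF" and VV_VF [simp]: "X \<in> VV \<Longrightarrow> X \<in> VF"
  and HF_H [simp]: "X \<in> HF \<Longrightarrow> X p \<in> H p" and VV_V [simp]: "X \<in> VV \<Longrightarrow> X p \<in> V p"
  by (auto simp: smooth_sections_def)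

lemma splitting: "smooth_splitting A (2 * m) 2 H V"
  using hol by (auto simp: holonomy_splitting_Um_U1_def)

lemma subspace_H: "subspace (H p)" and subspace_V: "subspace (V p)"
  and dim_V: "dim (V p) = 2"
  and T_eq: "T p = {u + v |u v. u \<in> H p \<and> v \<in> V p}"
  using splitting by (simp_all add: smooth_splitting_def)

lemma H_T: "u \<in> H p \<Longrightarrow> u \<in> T p"
  using subspace_0[OF subspace_V[of p]] unfolding T_eq by (metis (mono_tags, lifting) CollectI add_0_right)

lemma V_T: "u \<in> V p \<Longrightarrow> u \<in> T p"
  using subspace_0[OF subspace_H[of p]] unfolding T_eq by (metis (mono_tags, lifting) CollectI add_0_left)

lemma decompose:
  assumes "X \<in> VF"
  obtains Y Z where "Y \<in> HF" "Z \<in> VV" "X = Y + Z"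
  using splitting assms by (auto simp: smooth_splitting_def)

lemma g_HV: "u \<in> H p \<Longrightarrow> v \<in> V p \<Longrightarrow> g p u v = 0"
  and J_H: "u \<in> H p \<Longrightarrow> J p u \<in> H p" and J_V: "v \<in> V p \<Longrightarrow> J p v \<in> V p"
  and D_HF [simp]: "X \<in> VF \<Longrightarrow> Y \<in> HF \<Longrightarrow> D X Y \<in> HF"
  and D_VV [simp]: "X \<in> VF \<Longrightarrow> Z \<in> VV \<Longrightarrow> D X Z \<in> VV"
  using hol by (auto simp: holonomy_splitting_Um_U1_def parallel_distribution_def)

lemma HF_JJ [simp]: "X \<in> HF \<Longrightarrow> JJ X \<in> HF"
  by (rule smooth_sections_I) (simp_all add: J_H apply_endo_apply)

lemma VV_JJ [simp]: "X \<in> VV \<Longrightarrow> JJ X \<in> VV"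
  by (rule smooth_sections_I) (simp_all add: J_V apply_endo_apply)

lemma HF_diff [simp]: "X \<in> HF \<Longrightarrow> Y \<in> HF \<Longrightarrow> X - Y \<in> HF"
  by (rule smooth_sections_I) (simp_all add: subspace_diff[OF subspace_H])

lemma VV_diff [simp]: "X \<in> VV \<Longrightarrow> Y \<in> VV \<Longrightarrow> X - Y \<in> VV"
  by (rule smooth_sections_I) (simp_all add: subspace_diff[OF subspace_V])

lemma HF_uminus [simp]: "X \<in> HF \<Longrightarrow> - X \<in> HF"
  by (rule smooth_sections_I) (simp_all add: subspace_neg[OF subspace_H])

lemma G_HV: "X \<in> HF \<Longrightarrow> Z \<in> VV \<Longrightarrow> G X Z = 0"
  by (simp add: G_def g_HV fun_eq_iff)

lemma G_VH: "X \<in> HF \<Longrightarrow> Z \<in> VV \<Longrightarrow> G Z X = 0"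
  using G_HV G_sym by simp

lemma curvature_HF [simp]: "X \<in> VF \<Longrightarrow> Y \<in> VF \<Longrightarrow> Z \<in> HF \<Longrightarrow> curvature D X Y Z \<in> HF"
  and curvature_VV [simp]: "X \<in> VF \<Longrightarrow> Y \<in> VF \<Longrightarrow> Z' \<in> VV \<Longrightarrow> curvature D X Y Z' \<in> VV"
  by (simp_all add: curvature_def)

text \<open>Collects the linear consequences of the type condition that are used later. The last
  clause does not mention the eigenvalue: \<open>\<epsilon>\<close> on the H factor and
  \<open>- \<epsilon>\<close> on the V factor give the same relation for both signs, so both
  summands lie in one real subspace.\<close>

definition torsion_type :: "'a \<Rightarrow> ('a tvec \<Rightarrow> 'a tvec \<Rightarrow> 'a tvec \<Rightarrow> complex) set" where
  "torsion_type p = {\<omega>. (\<forall>c. \<forall>u\<in>T p. \<forall>v\<in>T p. \<forall>w\<in>T p. \<omega> (c *\<^sub>R u) v w = c *\<^sub>R \<omega> u v w) \<and>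
     (\<forall>u\<in>H p. \<forall>v\<in>H p. \<forall>w\<in>H p. \<omega> u v w = 0) \<and>
     (\<forall>u\<in>T p. \<forall>v\<in>V p. \<forall>w\<in>V p. \<omega> u v w = 0) \<and>
     (\<forall>u\<in>H p. \<forall>v\<in>H p. \<forall>w\<in>V p. \<omega> (J p u) v w = - \<omega> u v (J p w))}"

lemma subspace_torsion_type: "subspace (torsion_type p)"
  unfolding subspace_def torsion_type_def by (auto simp: scaleR_fun_def algebra_simps)

text \<open>Polarization. It carries the vanishing on V, imposed only in the first slot of a
  two-form, over to the second.\<close>

lemma two_forms_skew:
  assumes "\<alpha> \<in> two_forms \<epsilon> (T p) K j" "u \<in> T p" "v \<in> T p"
  shows "\<alpha> u v = - \<alpha> v u"
proof -
  have bil: "\<alpha> (x + y) z = \<alpha> x z + \<alpha> y z" "\<alpha> z (x + y) = \<alpha> z x + \<alpha> z y"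
    if "x \<in> T p" "y \<in> T p" "z \<in> T p" for x y z
    using assms(1) that by (auto simp: two_forms_def bilinear_within_def linear_within_def)
  have alt: "\<alpha> x x = 0" if "x \<in> T p" for x
    using assms(1) that by (auto simp: two_forms_def)
  have "\<alpha> (u + v) (u + v) = 0" using assms by (intro alt) auto
  moreover have "\<alpha> (u + v) (u + v) = \<alpha> u u + \<alpha> v u + (\<alpha> u v + \<alpha> v v)"
    using assms by (simp only: bil T_closed)
  ultimately show ?thesis
    using alt[of u] alt[of v] assms by (simp add: add_eq_0_iff2)
qed

text \<open>\<open>\<alpha>\<close> dies on V and \<open>\<beta>\<close> on H. On (H,H,V) only
  \<open>\<alpha> u v * \<beta> w\<close> survives, where moving J from \<open>u\<close> to
  \<open>w\<close> replaces the factor \<open>\<epsilon>\<close> by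
  \<open>- \<epsilon>\<close>.\<close>

lemma wedge21_torsion_type:
  assumes a: "\<alpha> \<in> two_forms \<epsilon> (T p) (V p) (J p)" and b: "\<beta> \<in> one_forms (- \<epsilon>) (T p) (H p) (J p)"
  shows "wedge21 \<alpha> \<beta> \<in> torsion_type p"
proof -
  have a1: "\<alpha> (c *\<^sub>R u) v = c *\<^sub>R \<alpha> u v" "\<alpha> v (c *\<^sub>R u) = c *\<^sub>R \<alpha> v u" if "u \<in> T p" "v \<in> T p" for c u v
    using a that by (auto simp: two_forms_def bilinear_within_def linear_within_def)
  have a2: "\<alpha> u v = 0" if "u \<in> V p" "v \<in> T p" for u v
    using a that by (auto simp: two_forms_def)
  have a3: "\<alpha> v u = 0" if "u \<in> V p" "v \<in> T p" for u v
    using two_forms_skew[OF a, of v u] a2 that V_T by simp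
  have a4: "\<alpha> (J p u) v = \<epsilon> * \<alpha> u v" if "u \<in> T p" "v \<in> T p" for u v
    using a that by (auto simp: two_forms_def)
  have b1: "\<beta> (c *\<^sub>R u) = c *\<^sub>R \<beta> u" if "u \<in> T p" for c u
    using b that by (auto simp: one_forms_def linear_within_def)
  have b2: "\<beta> u = 0" if "u \<in> H p" for u
    using b that by (auto simp: one_forms_def)
  have b3: "\<beta> (J p u) = - \<epsilon> * \<beta> u" if "u \<in> T p" for u
    using b that by (auto simp: one_forms_def)
  show ?thesis
    unfolding torsion_type_def wedge21_def
    by (auto simp: a1 a2 a3 a4 b1 b2 b3 H_T V_T J_H J_V algebra_simps)
qed

lemma tensor_forms_torsion_type:
  assumes "\<omega> \<in> tensor_forms (two_forms \<epsilon> (T p) (V p) (J p)) (one_forms (- \<epsilon>) (T p) (H p) (J p))"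
  shows "\<omega> \<in> torsion_type p"
proof -
  have "tensor_forms (two_forms \<epsilon> (T p) (V p) (J p)) (one_forms (- \<epsilon>) (T p) (H p) (J p))
      \<subseteq> torsion_type p"
    unfolding tensor_forms_def
    by (rule span_minimal) (auto intro: wedge21_torsion_type subspace_torsion_type)
  then show ?thesis using assms by auto
qed

lemma torsion3_form:
  "\<exists>\<omega>\<in>torsion_type p. \<forall>X\<in>VF. \<forall>Y\<in>VF. \<forall>Z\<in>VF.
     complex_of_real (torsion3 g D X Y Z p) = \<omega> (X p) (Y p) (Z p)"
proof -
  from tor obtain \<omega>\<^sub>1 \<omega>\<^sub>2 where
    1: "\<omega>\<^sub>1 \<in> tensor_forms (Lambda20 (T p) (V p) (J p)) (Lambda01 (T p) (H p) (J p))" and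
    2: "\<omega>\<^sub>2 \<in> tensor_forms (Lambda02 (T p) (V p) (J p)) (Lambda10 (T p) (H p) (J p))" and
    eq: "\<forall>X\<in>VF. \<forall>Y\<in>VF. \<forall>Z\<in>VF. complex_of_real (torsion3 g D X Y Z p) =
            \<omega>\<^sub>1 (X p) (Y p) (Z p) + \<omega>\<^sub>2 (X p) (Y p) (Z p)"
    unfolding torsion_type_condition_def Let_def by blast
  have "\<omega>\<^sub>1 + \<omega>\<^sub>2 \<in> torsion_type p"
    \<comment> \<open>The second summand is the case \<open>\<epsilon> = - \<i>\<close>; the
      explicit instance lets \<open>- (- \<i>)\<close> simplify to \<open>\<i>\<close>.\<close>
    using tensor_forms_torsion_type[OF 1] tensor_forms_torsion_type[of \<omega>\<^sub>2 "- \<i>" p] 2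
    by (intro subspace_add subspace_torsion_type) auto
  with eq show ?thesis by (intro bexI[of _ "\<omega>\<^sub>1 + \<omega>\<^sub>2"]) auto
qed

text \<open>The type condition already represents the torsion at \<open>p\<close> by a form
  evaluated on the values at \<open>p\<close>, so homogeneity of that form suffices.\<close>

lemma torsion3_fmult:
  assumes "X \<in> VF" "Y \<in> VF" "Z \<in> VF" "f \<in> smooth_functions A"
  shows "torsion3 g D (fmult f X) Y Z = f * torsion3 g D X Y Z"
proof
  fix p
  obtain \<omega> where o: "\<omega> \<in> torsion_type p" "\<forall>X\<in>VF. \<forall>Y\<in>VF. \<forall>Z\<in>VF.
     complex_of_real (torsion3 g D X Y Z p) = \<omega> (X p) (Y p) (Z p)"
    using torsion3_form[of p] by blast
  have "fmult f X p = f p *\<^sub>R X p" by (simp add: fmult_def)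
  then have "complex_of_real (torsion3 g D (fmult f X) Y Z p) = \<omega> (f p *\<^sub>R X p) (Y p) (Z p)"
    using assms o(2) by (metis VF_closed(5))
  also have "\<dots> = f p *\<^sub>R \<omega> (X p) (Y p) (Z p)"
    using assms o(1) by (simp add: torsion_type_def)
  also have "\<dots> = complex_of_real (f p * torsion3 g D X Y Z p)"
    using assms o(2) by (simp add: scaleR_conv_of_real)
  finally show "torsion3 g D (fmult f X) Y Z p = (f * torsion3 g D X Y Z) p"
    by (simp only: of_real_eq_iff times_fun_apply)
qed

section \<open>Components of the torsion along the splitting\<close>

lemma torsion3_HHH: "X \<in> HF \<Longrightarrow> Y \<in> HF \<Longrightarrow> Z \<in> HF \<Longrightarrow> torsion3 g D X Y Z = 0"
  and torsion3_VV: "X' \<in> VF \<Longrightarrow> Y' \<in> VV \<Longrightarrow> Z' \<in> VV \<Longrightarrow> torsion3 g D X' Y' Z' = 0"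
  and torsion3_JJ: "X \<in> HF \<Longrightarrow> Y \<in> HF \<Longrightarrow> Z' \<in> VV \<Longrightarrow>
    torsion3 g D (JJ X) Y Z' = - torsion3 g D X Y (JJ Z')"
proof -
  obtain \<omega> where o: "\<And>p. \<omega> p \<in> torsion_type p" and
    \<omega>: "\<And>X Y Z p. X \<in> VF \<Longrightarrow> Y \<in> VF \<Longrightarrow> Z \<in> VF \<Longrightarrow>
       complex_of_real (torsion3 g D X Y Z p) = \<omega> p (X p) (Y p) (Z p)"
    using torsion3_form by metis
  have eq: "torsion3 g D X Y Z p = Re (\<omega> p (X p) (Y p) (Z p))"
    if "X \<in> VF" "Y \<in> VF" "Z \<in> VF" for X Y Z p
    using \<omega>[OF that, of p] by (metis Re_complex_of_real)
  show "X \<in> HF \<Longrightarrow> Y \<in> HF \<Longrightarrow> Z \<in> HF \<Longrightarrow> torsion3 g D X Y Z = 0"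
    using o by (simp add: fun_eq_iff eq torsion_type_def)
  show "X' \<in> VF \<Longrightarrow> Y' \<in> VV \<Longrightarrow> Z' \<in> VV \<Longrightarrow> torsion3 g D X' Y' Z' = 0"
    using o by (simp add: fun_eq_iff eq torsion_type_def)
  show "X \<in> HF \<Longrightarrow> Y \<in> HF \<Longrightarrow> Z' \<in> VV \<Longrightarrow>
    torsion3 g D (JJ X) Y Z' = - torsion3 g D X Y (JJ Z')"
    using o by (simp add: fun_eq_iff eq torsion_type_def apply_endo_apply)
qed

text \<open>The H-component \<open>Y\<close> of \<open>X\<close> satisfies
  \<open>G Y Y = G X Y = 0\<close>, hence vanishes.\<close>

lemma VV_I:
  assumes "X \<in> VF" "\<And>Y. Y \<in> HF \<Longrightarrow> G X Y = 0"
  shows "X \<in> VV"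
proof -
  obtain Y Z where YZ: "Y \<in> HF" "Z \<in> VV" "X = Y + Z" using decompose assms(1) by blast
  then have "G Y Y = 0" using assms(2)[OF YZ(1)] by (simp add: G_add_left G_VH)
  then have "Y p = 0" for p using G_self_zero[of Y p] YZ by simp
  then have "Y = 0" by (simp add: fun_eq_iff)
  then show ?thesis using YZ by simp
qed

lemma HF_I:
  assumes "X \<in> VF" "\<And>Y. Y \<in> VV \<Longrightarrow> G X Y = 0"
  shows "X \<in> HF"
proof -
  obtain Y Z where YZ: "Y \<in> HF" "Z \<in> VV" "X = Y + Z" using decompose assms(1) by blast
  then have "G Z Z = 0" using assms(2)[OF YZ(2)] by (simp add: G_add_left G_HV)
  then have "Z p = 0" for p using G_self_zero[of Z p] YZ by simp
  then have "Z = 0" by (simp add: fun_eq_iff)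
  then show ?thesis using YZ by simp
qed

text \<open>These memberships eliminate most of the quadratic torsion terms in the Bianchi
  components.\<close>

lemma torsion_HH [simp]: "X \<in> HF \<Longrightarrow> Y \<in> HF \<Longrightarrow> torsion D X Y \<in> VV"
  using torsion3_HHH[of X Y] by (intro VV_I) (simp_all flip: torsion3_G)

lemma torsion_VH [simp]:
  assumes "X \<in> VV" "Y \<in> HF" shows "torsion D X Y \<in> HF"
proof (rule HF_I)
  fix Z assume "Z \<in> VV"
  then show "G (torsion D X Y) Z = 0"
    using assms torsion3_VV[of Y X Z] torsion3_skew12[of X Y Z] by (simp flip: torsion3_G)
qed (use assms in simp)

lemma torsion_HV [simp]: "X \<in> VV \<Longrightarrow> Y \<in> HF \<Longrightarrow> torsion D Y X \<in> HF"
  by (subst torsion_skew) simp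

section \<open>Components of the differentiated torsion along the splitting\<close>

lemma F_HHH: "X \<in> VF \<Longrightarrow> Y \<in> HF \<Longrightarrow> Z \<in> HF \<Longrightarrow> W \<in> HF \<Longrightarrow> F X Y Z W = 0"
  by (simp add: cov_deriv3_def torsion3_HHH deriv_along_def tangent_zero[OF VF_T] fun_eq_iff)

lemma deriv_along_0: "X \<in> VF \<Longrightarrow> deriv_along X 0 = 0"
  by (simp add: deriv_along_def tangent_zero[OF VF_T] fun_eq_iff)

lemma F_VV: "X \<in> VF \<Longrightarrow> Y \<in> VF \<Longrightarrow> Z \<in> VV \<Longrightarrow> W \<in> VV \<Longrightarrow> F X Y Z W = 0"
  by (simp add: cov_deriv3_def torsion3_VV deriv_along_0)

text \<open>The relation \<open>torsion3_JJ\<close> survives differentiation because J, H and V are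
  parallel. The digits count the direction of differentiation as slot 1, whereas those of
  \<open>F_skew12\<close> and \<open>F_skew23\<close> count only the form slots.\<close>

lemma F_JJ24:
  "X \<in> VF \<Longrightarrow> Y \<in> HF \<Longrightarrow> Z \<in> HF \<Longrightarrow> W \<in> VV \<Longrightarrow> F X (JJ Y) Z W = - F X Y Z (JJ W)"
  by (simp add: cov_deriv3_def D_JJ torsion3_JJ deriv_along_uminus)

text \<open>Needed to expand a direction in V with function coefficients. Skewness moves the
  multiplied argument into the first form slot, where \<open>torsion3_fmult\<close> applies.\<close>

lemma F_fmult:
  assumes "X \<in> VF" "Y \<in> VF" "Z \<in> VF" "W \<in> VF" "f \<in> smooth_functions A"
  shows "F (fmult f X) Y Z W = f * F X Y Z W"
proof -
  have 2: "torsion3 g D Y (fmult f U) W = f * torsion3 g D Y U W" if "U \<in> VF" for U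
    using that assms torsion3_skew12[of Y "fmult f U" W] torsion3_skew12[of Y U W]
    by (simp add: torsion3_fmult)
  have 3: "torsion3 g D Y Z (fmult f U) = f * torsion3 g D Y Z U" if "U \<in> VF" for U
    using that assms torsion3_skew23[of Y Z "fmult f U"] torsion3_skew23[of Y Z U]
      torsion3_skew12[of Y "fmult f U" Z] torsion3_skew12[of Y U Z]
    by (simp add: torsion3_fmult)
  have 1: "deriv_along (fmult f X) h = f * deriv_along X h" for h
    by (simp add: deriv_along_def fmult_def scaleR_fun_def fun_eq_iff)
  show ?thesis
    using assms by (simp add: cov_deriv3_def D_fmult_left torsion3_fmult 1 2 3 right_diff_distrib)
qed


subsection \<open>The components of the first Bianchi identity\<close>

lemma bianchi_G:
  assumes "X \<in> VF" "Y \<in> VF" "Z \<in> VF" "W \<in> VF"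
  shows "G (curvature D X Y Z) W + G (curvature D Y Z X) W + G (curvature D Z X Y) W =
    (F X Y Z W + F Y Z X W + F Z X Y W) +
    (torsion3 g D (torsion D X Y) Z W + torsion3 g D (torsion D Y Z) X W
      + torsion3 g D (torsion D Z X) Y W)"
  using arg_cong[OF first_bianchi[OF assms(1-3)], of "\<lambda>S. G S W"] assms
  by (simp add: G_add_left F_G torsion3_G)

text \<open>Pairing with \<open>W\<close> kills everything else: the curvature preserves H, and the
  torsion of a V-field with an H-field lies in H.\<close>

lemma F_cyclic:
  assumes [simp]: "X \<in> HF" "Y \<in> HF" "Z \<in> HF" "W \<in> VV"
  shows "F X Y Z W + F Y Z X W + F Z X Y W = 0"
  using bianchi_G[of X Y Z W] by (simp add: torsion3_G G_HV)

lemma F_JJ34: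
  assumes [simp]: "X \<in> VF" "Y \<in> HF" "Z \<in> HF" "W \<in> VV"
  shows "F X Y (JJ Z) W = - F X Y Z (JJ W)"
  using F_JJ24[of X Z Y W] F_skew12[of X Y "JJ Z" W] F_skew12[of X Y Z "JJ W"] by simp

lemma F_uminus4:
  assumes [simp]: "X \<in> VF" "Y \<in> VF" "Z \<in> VF" "W \<in> VF"
  shows "F X Y Z (- W) = - F X Y Z W"
  by (simp add: F_G G_uminus_right)

lemma F_JJ23:
  assumes [simp]: "X \<in> VF" "Y \<in> HF" "Z \<in> HF" "W \<in> VV"
  shows "F X (JJ Y) (JJ Z) W = - F X Y Z W"
  by (simp add: F_JJ24 F_JJ34 F_uminus4)

text \<open>The part of \<open>F\<close> that is antilinear in its first slot relative to the next two is killed by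
  the cyclic identity: in each cyclic sum with one antilinear argument only one term is nonzero.\<close>

lemma F_JJ14:
  assumes [simp]: "X \<in> HF" "Y \<in> HF" "Z \<in> HF" "W \<in> VV"
  shows "F (JJ X) Y Z (JJ W) = F X Y Z W"
proof
  fix p
  have c: "F X Y Z W p + F Y Z X W p + F Z X Y W p = 0"
    if "X \<in> HF" "Y \<in> HF" "Z \<in> HF" for X Y Z
    using fun_cong[OF F_cyclic[OF that assms(4)], of p] by simp
  show "F (JJ X) Y Z (JJ W) p = F X Y Z W p"
    \<comment> \<open>Let a, b, c be the three cyclic terms and a', b', c' the same terms with J in
      slots 1 and 4. The instances read a + b + c = 0, a + b' + c' = 0, a' + b' + c = 0 and a' + b +
      c' = 0. Adding the last three gives a' + b' + c' = 0, so a = a'.\<close>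
    using c[of X Y Z] c[of X "JJ Y" "JJ Z"] c[of "JJ X" "JJ Y" Z] c[of "JJ X" Y "JJ Z"]
    by (simp add: F_JJ24 F_JJ34 F_uminus4)
qed

text \<open>In the identity for \<open>X\<close>, \<open>Y\<close>, \<open>W\<close> paired with
  \<open>Z\<close>, the term with \<open>curvature D X Y W\<close> lies in V and
  \<open>F W X Y Z\<close> is purely horizontal, so both drop out. The torsion terms vanish by type,
  and \<open>F_cyclic\<close> merges the two remaining derivatives.\<close>

lemma bianchi_HHV:
  assumes [simp]: "X \<in> HF" "Y \<in> HF" "Z \<in> HF" "W \<in> VV"
  shows "G (curvature D Y W X) Z + G (curvature D W X Y) Z = F Z X Y W"
proof -
  have "torsion3 g D (torsion D X Y) W Z = 0"
    using torsion3_VV[of Z W "torsion D X Y"] torsion3_skew23[of "torsion D X Y" W Z]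
      torsion3_skew12[of "torsion D X Y" Z W] torsion3_skew23[of Z "torsion D X Y" W] by simp
  then have "G (curvature D Y W X) Z + G (curvature D W X Y) Z = F X Y W Z + F Y W X Z"
    using bianchi_G[of X Y W Z] by (simp add: torsion3_G G_VH F_HHH)
  also have "\<dots> = - F X Y Z W - F Y Z X W"
    using F_skew23[of X Y W Z] F_skew12[of Y W X Z] F_skew23[of Y X W Z] F_skew12[of Y X Z W] by simp
  also have "\<dots> = F Z X Y W"
    using F_cyclic[OF assms] by (simp add: algebra_simps add_eq_0_iff)
  finally show ?thesis .
qed

lemma F_HHHV:
  assumes [simp]: "X \<in> HF" "Y \<in> HF" "Z \<in> HF" "W \<in> VV"
  shows "F Z X Y W = 0"
proof
  fix p
  have c: "G (curvature D Y W X) Z p + G (curvature D W X Y) Z p = F Z X Y W p"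
    if "X \<in> HF" "Y \<in> HF" "Z \<in> HF" for X Y Z
    using fun_cong[OF bianchi_HHV[OF that assms(4)], of p] by simp
  have "F (JJ Z) (JJ X) Y W = - F Z X Y W" "F (JJ Z) X (JJ Y) W = - F Z X Y W"
    by (simp_all add: F_JJ24 F_JJ34 F_JJ14)
  then show "F Z X Y W p = 0 p"
    \<comment> \<open>Write f for \<open>F Z X Y W\<close>, r and r' for the two curvature terms,
      and s (from r') and t (from r) for those with J on \<open>X\<close> and \<open>Z\<close>,
      respectively on \<open>Y\<close> and \<open>Z\<close>, where this J acts in one curvature
      direction. The instances read r + r' = f, r + s = -f, r' + t = -f and s + t = f. Comparing the
      outer two with the inner two gives f = 0.\<close>
    using c[of X Y Z] c[of "JJ X" Y "JJ Z"] c[of X "JJ Y" "JJ Z"] c[of "JJ X" "JJ Y" Z]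
    by (simp add: curvature_JJ G_JJ G_JJ_left G_uminus_right F_JJ23)
qed

text \<open>Taking the same \<open>W\<close> as third argument and as pairing partner makes the
  vertical curvature term vanish by \<open>curvature_metric_diag\<close>.\<close>

lemma F_VHHV_diag:
  assumes [simp]: "X \<in> HF" "Y \<in> HF" "W \<in> VV"
  shows "F W X Y W = 0"
proof -
  \<comment> \<open>Rewrites the two remaining quadratic terms as the inner product of
    \<open>torsion D X W\<close> and \<open>torsion D Y W\<close> with opposite signs.\<close>
  have "torsion3 g D U X' W = G (torsion D X' W) U" if [simp]: "U \<in> VF" "X' \<in> VF" for U X'
    using torsion3_skew12[of U X' W] torsion3_skew23[of X' U W] by (simp flip: torsion3_G)
  moreover have "torsion D W X = - torsion D X W"
    by (rule torsion_skew)
  ultimately have "torsion3 g D (torsion D Y W) X W + torsion3 g D (torsion D W X) Y W = 0"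
    using G_sym[of "torsion D X W" "torsion D Y W"] by (simp add: G_uminus_right)
  moreover have "torsion3 g D (torsion D X Y) W W = 0"
    by (simp add: torsion3_VV)
  moreover have "F Y W X W = 0"
    using F_skew12[of Y W X W] by (simp add: F_VV)
  ultimately show ?thesis
    using bianchi_G[of X Y W W]
    by (simp add: curvature_metric_diag G_HV F_VV add.assoc)
qed

lemma F_VHHV_JJ:
  assumes [simp]: "X \<in> HF" "Y \<in> HF" "W \<in> VV"
  shows "F (JJ W) X Y W = 0"
proof -
  \<comment> \<open>Writing \<open>X\<close> as \<open>JJ (JJ (- X))\<close> frees one J to move
    onto the last slot, which becomes the diagonal case for \<open>JJ W\<close>.\<close>
  have "F (JJ W) (JJ (JJ (- X))) Y W = 0"
    by (subst F_JJ24) (simp_all add: F_VHHV_diag)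
  then show ?thesis by simp
qed

text \<open>For nonzero \<open>w\<close>, the vectors \<open>w\<close> and \<open>J p w\<close> are
  orthogonal of equal length, so they span the plane \<open>V p\<close>. Clearing the denominator
  \<open>g p w w\<close> covers zeros of \<open>w\<close> and leaves smooth coefficients.\<close>

lemma V_rank_two:
  assumes v: "v \<in> V p" and w: "w \<in> V p"
  shows "g p w w *\<^sub>R v = g p v w *\<^sub>R w + g p v (J p w) *\<^sub>R J p w"
proof (cases "w = 0")
  case True
  have "J p 0 = 0" using J_scale[of 0 p 0] by simp
  then show ?thesis using True v by (simp add: g_zero V_T)
next
  case False
  let ?u = "J p w"
  have T [simp]: "v \<in> T p" "w \<in> T p" "?u \<in> T p" using v w by (auto simp: V_T)
  have neg: "g p a (- b) = - g p a b" if "a \<in> T p" "b \<in> T p" for a b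
    using that g_scale_left[of b p a "-1"] g_sym[of a p b] g_sym[of a p "-b"] by simp
  have orth: "g p w ?u = 0"
    using gJ[of w p ?u] g_sym[of w p ?u] neg[of ?u w] by simp
  have pos: "g p w w > 0" using g_pos False by simp
  have nu: "g p ?u ?u = g p w w" by (simp add: gJ)
  have indep: "independent {w, ?u}"
  proof -
    have "?u \<notin> span {w}"
    proof
      assume "?u \<in> span {w}"
      then obtain c where "?u = c *\<^sub>R w" by (auto simp: span_singleton)
      then have "g p ?u ?u = c * g p w ?u" using g_scale_left[of w p ?u c] by simp
      then show False using orth pos nu by simp
    qed
    then have "independent (insert ?u {w})" using False by (simp add: independent_insert)
    then show ?thesis by (simp add: insert_commute)
  qed
  have "v \<in> span {w, ?u}"
  proof (rule ccontr)
    assume nin: "v \<notin> span {w, ?u}"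
    then have ind3: "independent (insert v {w, ?u})"
      using indep by (simp add: independent_insertI)
    have "w \<noteq> ?u" using orth pos by auto
    then have card3: "card (insert v {w, ?u}) = 3"
      using nin span_base[of v "{w, ?u}"] by (auto simp: card_insert_if)
    obtain B where B: "B \<subseteq> V p" "independent B" "V p \<subseteq> span B" "card B = dim (V p)"
      using basis_exists by blast
    \<comment> \<open>An infinite set has \<open>card\<close> 0, which differs from the dimension
      2.\<close>
    then have "finite B" using dim_V[of p] by (metis card.infinite zero_neq_numeral)
    moreover have "insert v {w, ?u} \<subseteq> span B" using v w J_V B(3) by auto
    ultimately have "card (insert v {w, ?u}) \<le> card B"
      using independent_span_bound ind3 by blast
    then show False using card3 B(4) dim_V[of p] by simp
  qed
  then obtain a b where v_eq: "v = a *\<^sub>R w + b *\<^sub>R ?u"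
    by (auto simp: span_insert span_singleton algebra_simps)
  have "g p v w = a * g p w w" "g p v ?u = b * g p w w"
    using orth nu g_sym[of ?u p w] unfolding v_eq by (simp_all add: g_add_left g_scale_left)
  then show ?thesis
    by (simp only:) (simp add: v_eq algebra_simps)
qed

text \<open>Expand \<open>S\<close> in \<open>W\<close> and \<open>JJ W\<close>: both directions are
  already settled, so \<open>F S X Y W\<close> vanishes wherever \<open>W\<close> does not.\<close>

lemma F_VHHV:
  assumes [simp]: "S \<in> VV" "X \<in> HF" "Y \<in> HF" "W \<in> VV"
  shows "F S X Y W = 0"
proof
  fix p
  have "fmult (G W W) S = fmult (G S W) W + fmult (G S (JJ W)) (JJ W)"
    by (rule ext) (simp only: fmult_def plus_fun_apply G_def apply_endo_apply V_rank_two VV_V assms)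
  then have "G W W * F S X Y W = F (fmult (G S W) W + fmult (G S (JJ W)) (JJ W)) X Y W"
    using F_fmult[of S X Y W "G W W"] by simp
  also have "\<dots> = 0"
    by (simp add: F_add1 F_fmult F_VHHV_diag F_VHHV_JJ)
  finally have z: "G W W p * F S X Y W p = 0"
    by (metis times_fun_apply zero_fun_apply)
  show "F S X Y W p = 0 p"
  proof (cases "G W W p = 0")
    case True
    \<comment> \<open>At a zero of \<open>W\<close> the last argument of the tensor vanishes
      instead.\<close>
    then have "W p = 0" by (intro G_self_zero) auto
    then show ?thesis by (simp add: F_G G_def g_zero)
  next
    case False
    then show ?thesis using z by simp
  qed
qed

section \<open>Assembly of all components\<close>

lemma F_HHV:
  assumes "X \<in> VF" "Y \<in> HF" "Z \<in> HF" "W \<in> VV"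
  shows "F X Y Z W = 0"
proof -
  obtain X1 X2 where "X1 \<in> HF" "X2 \<in> VV" "X = X1 + X2" using decompose assms(1) by blast
  then show ?thesis using assms by (simp add: F_add1 F_HHHV F_VHHV)
qed

lemma F_add3:
  assumes "X \<in> VF" "Y \<in> VF" "Z \<in> VF" "Z' \<in> VF" "W \<in> VF"
  shows "F X Y (Z + Z') W = F X Y Z W + F X Y Z' W"
  using assms F_skew23[of X Y "Z + Z'" W] F_skew23[of X Y Z W] F_skew23[of X Y Z' W]
  by (simp add: F_add4)

lemma F_add2:
  assumes "X \<in> VF" "Y \<in> VF" "Y' \<in> VF" "Z \<in> VF" "W \<in> VF"
  shows "F X (Y + Y') Z W = F X Y Z W + F X Y' Z W"
  using assms F_skew12[of X "Y + Y'" Z W] F_skew12[of X Y Z W] F_skew12[of X Y' Z W]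
  by (simp add: F_add3)

lemma F_zero:
  assumes [simp]: "X \<in> VF" and "Y \<in> VF" "Z \<in> VF" "W \<in> VF"
  shows "F X Y Z W = 0"
proof -
  obtain Y1 Y2 where [simp]: "Y1 \<in> HF" "Y2 \<in> VV" and Y: "Y = Y1 + Y2"
    using decompose assms(2) by blast
  obtain Z1 Z2 where [simp]: "Z1 \<in> HF" "Z2 \<in> VV" and Z: "Z = Z1 + Z2"
    using decompose assms(3) by blast
  obtain W1 W2 where [simp]: "W1 \<in> HF" "W2 \<in> VV" and W: "W = W1 + W2"
    using decompose assms(4) by blast
  \<comment> \<open>Of the eight components these four do not have their arguments in the order of
    \<open>F_HHH\<close>, \<open>F_HHV\<close> or \<open>F_VV\<close>; skewness rearranges
    them.\<close>
  have "F X Y1 Z2 W1 = 0" using F_skew23[of X Y1 Z2 W1] by (simp add: F_HHV)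
  moreover have "F X Y2 Z1 W1 = 0"
    using F_skew12[of X Y2 Z1 W1] F_skew23[of X Z1 Y2 W1] by (simp add: F_HHV)
  moreover have "F X Y2 Z1 W2 = 0" using F_skew12[of X Y2 Z1 W2] by (simp add: F_VV)
  moreover have "F X Y2 Z2 W1 = 0"
    using F_skew23[of X Y2 Z2 W1] F_skew12[of X Y2 W1 Z2] by (simp add: F_VV)
  ultimately show ?thesis
    unfolding Y Z W by (simp add: F_add2 F_add3 F_add4 F_HHH F_HHV F_VV)
qed

end

theorem corollary3p3:
  fixes A :: "('a::{t2_space, second_countable_topology}, 'e::euclidean_space) atlas"
    and g :: "'a \<Rightarrow> 'a tvec \<Rightarrow> 'a tvec \<Rightarrow> real"
    and J :: "'a \<Rightarrow> 'a tvec \<Rightarrow> 'a tvec"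
    and D :: "'a connection"
    and H V :: "'a \<Rightarrow> 'a tvec set"
    and m :: nat
  assumes "DIM('e) = 2 * m + 2"
    and "hermitian_manifold A g J"
    and "skew_torsion_hermitian_connection A g J D"
    and "holonomy_splitting_Um_U1 A g J D m H V"
    and "torsion_type_condition A g J D H V"
  shows "\<forall>X\<in>vector_fields A. \<forall>Y\<in>vector_fields A. \<forall>Z\<in>vector_fields A. \<forall>W\<in>vector_fields A.
           cov_deriv3 D (torsion3 g D) X Y Z W = 0"
proof -
  interpret skew_torsion_splitting A g J D H V m
    using assms(2-5) by unfold_locales
  show ?thesis using F_zero by blast
qed

end
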